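(* Suppose that $(P_n)_{n\in\mathbb{N}}$ is a sequence of polynomials with integer coefficients, $\deg P_n = n$, such that each $P_n$ has no multiple zeros (in $\mathbb{C}$). If $\lim_{n\to\infty} \|P_n\|_0^{1/n} = 1$, then the normalized zero counting measures $\nu_n$ of $P_n$ converge to the normalized arclength measure $d\theta/(2\pi)$ on the unit circle $\mathbb{T}=\{z\in\mathbb{C}:|z|=1\}$ in the weak* topology, as $n\to\infty$.
   Context: For a nonzero polynomial $P$ with complex coefficients, $$\|P\|_0 := \exp\left(\frac{1}{\pi}\iint_{\mathbb{D}}\log|P(z)|\,dA\right),$$ where $\mathbb{D}=\{z\in\mathbb{C}:|z|<1\}$ is the open unit disk and $dA$ is the area (Lebesgue) measure. For a polynomial $P_n(z)=a_n \prod_{j=1}^n (z-z_j)$ of degree $n$, the normalized zero counting measure is $\nu_n:= \frac{1}{n} \sum_{j=1}^n \delta_{z_j}$, where $\delta_{z_j}$ is the unit point mass at $z_j$. Weak* convergence of measures $\nu_n\to\nu$ on $\mathbb{C}$ means $\int f\,d\nu_n\to\int f\,d\nu$ for every continuous compactly supported function $f$ on $\mathbb{C}$. *)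

theory Defs
  imports "HOL-Analysis.Analysis" "HOL-Computational_Algebra.Polynomial"
begin

text \<open>The Bochner integral loses nothing here: for a nonzero polynomial the logarithm is
  integrable over the disk, and the convention \<^term>\<open>ln 0 = (0::real)\<close> only matters at the
  finitely many zeros.\<close>

definition area_mahler :: "complex poly \<Rightarrow> real" where
  "area_mahler p = exp (1 / pi * (LINT z:ball 0 1|lborel. ln (cmod (poly p z))))"

text \<open>Each zero carries mass \<^term>\<open>order z p / degree p\<close>, so zeros are counted with multiplicity.
  The push-forward along the identity turns the discrete measure into a Borel measure on the
  plane.\<close>

definition zero_counting_measure :: "complex poly \<Rightarrow> complex measure" where
  "zero_counting_measure p =
     distr (point_measure {z. poly p z = 0} (\<lambda>z. ennreal (real (order z p) / real (degree p))))
       borel (\<lambda>z. z)"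

definition unit_circle_measure :: "complex measure" where
  "unit_circle_measure = distr (uniform_measure lborel {0..<2 * pi}) borel cis"

definition weak_star_converges :: "(nat \<Rightarrow> complex measure) \<Rightarrow> complex measure \<Rightarrow> bool" where
  "weak_star_converges \<nu> \<mu> \<longleftrightarrow>
     (\<forall>f :: complex \<Rightarrow> complex. continuous_on UNIV f \<longrightarrow> compact (closure {z. f z \<noteq> 0}) \<longrightarrow>
        (\<lambda>n. LINT z|\<nu> n. f z) \<longlonglongrightarrow> (LINT z|\<mu>. f z))"

lemma emeasure_zero_counting_measure:
  assumes "p \<noteq> 0" "A \<in> sets borel"
  shows "emeasure (zero_counting_measure p) A =
           (\<Sum>z\<in>{z. poly p z = 0} \<inter> A. ennreal (real (order z p) / real (degree p)))"
proof -
  have fin: "finite {z. poly p z = 0}"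
    using assms(1) by (rule poly_roots_finite)
  have "emeasure (zero_counting_measure p) A =
      emeasure (point_measure {z. poly p z = 0} (\<lambda>z. ennreal (real (order z p) / real (degree p))))
        ({z. poly p z = 0} \<inter> A)"
    unfolding zero_counting_measure_def using assms(2)
    by (subst emeasure_distr) (auto simp: space_point_measure measurable_point_measure_eq1 Int_commute)
  also have "\<dots> = (\<Sum>z\<in>{z. poly p z = 0} \<inter> A. ennreal (real (order z p) / real (degree p)))"
    by (rule emeasure_point_measure_finite) (use fin in auto)
  finally show ?thesis .
qed

end

theory Submission
  imports Defs "Jordan_Normal_Form.Determinant"
    "HOL-Computational_Algebra.Fundamental_Theorem_Algebra" "HOL-Real_Asymp.Real_Asymp"
begin

text \<open>
  Averaging \<open>ln (cmod (z - w))\<close> over the disk shows that \<open>ln (area_mahler p)\<close> is at least the logarithm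
  of the classical Mahler measure minus half the sum of \<open>1 - (cmod w)\<^sup>2\<close> over the zeros \<open>w\<close> in
  the disk. Since the product of the leading coefficient and the nonzero zeros is a nonzero integer, the
  hypothesis forces both the Mahler measure and the mean distance of the zeros from the circle to
  be negligible.

  After reflecting the zeros into the closed disk, the pairwise distances are bounded by
  \<open>cmod (1 - u * cnj v)\<close>, up to the Mahler measure. Damping \<open>u * cnj v\<close> by a factor \<open>\<rho> < 1\<close> and
  expanding the logarithm turns the sum over all pairs into minus a weighted sum of squared power
  sums, whereas the discriminant, a nonzero integer, bounds the sum over distinct pairs from below.
  Hence every power sum of the reflected zeros is of order \<open>o(n)\<close>, and Weyl's criterion applies.
\<close>

section \<open>Integrality of the resultant\<close>

text \<open>The area mean is weaker than the Mahler measure: a zero of modulus \<open>h < 1\<close>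
  may lower its logarithm by \<open>(1 - h\<^sup>2) / 2\<close>, a first-order loss near the circle.
  In the integer product the same zero costs \<open>- ln h\<close>, which agrees with that loss to
  first order, so only a surplus \<open>(1 - h)\<^sup>2\<close> is controlled. Hence a sum of
  squares is bounded first, and Cauchy-Schwarz turns its o(n) bound into one for the sum of
  distances.

  Damping is forced by the diagonal: the pair of a zero with itself contributes
  \<open>ln (1 - (cmod u)\<^sup>2)\<close>, which is minus infinity on the circle. With \<rho> < 1
  the n diagonal terms cost \<open>- n * ln (1 - \<rho>)\<close> and the off-diagonal pairs
  \<open>ln (2 / (1 + \<rho>))\<close> each. For \<rho> = 1 - 1/n these totals are O(n ln n) and
  O(n), below the scale \<open>n\<^sup>2\<close> of squared power sums.

  Simplicity of the zeros enters twice: the discriminant is nonzero, and a zero at the origin has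
  order one, so that the product of the others with the leading coefficient is, up to sign, a
  coefficient.\<close>

lemma poly_eq_sum_lessThan:
  fixes p :: "'a :: idom poly"
  assumes "\<And>k. k \<ge> N \<Longrightarrow> coeff p k = 0"
  shows "poly p x = (\<Sum>k<N. coeff p k * x ^ k)"
proof -
  have "poly p x = (\<Sum>k\<le>degree p. coeff p k * x ^ k)"
    by (rule poly_altdef)
  also have "\<dots> = (\<Sum>k\<in>{..degree p} \<inter> {..<N}. coeff p k * x ^ k)"
      proof (rule sum.mono_neutral_right)
    show "\<forall>k\<in>{..degree p} - {..degree p} \<inter> {..<N}. coeff p k * x ^ k = 0"
      using assms by (auto simp: not_less)
  qed auto
  also have "\<dots> = (\<Sum>k<N. coeff p k * x ^ k)"
    by (rule sum.mono_neutral_left) (auto simp: le_degree)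
  finally show ?thesis .
qed

definition vander :: "nat \<Rightarrow> (nat \<Rightarrow> complex) \<Rightarrow> complex mat" where
  "vander n z = Matrix.mat n n (\<lambda>(k, c). z c ^ k)"

text \<open>A kernel vector of the transpose lists the coefficients of a polynomial of degree below
  \<open>n\<close> that has \<open>n\<close> distinct zeros. Nonvanishing suffices for
  \<open>det_sylv\<close>, where this determinant cancels.\<close>

lemma det_vander_nonzero:
  assumes inj: "inj_on z {..<n}"
  shows "Determinant.det (vander n z) \<noteq> 0"
proof
  assume "Determinant.det (vander n z) = 0"
  hence "Determinant.det (transpose_mat (vander n z)) = 0"
    by (subst Determinant.det_transpose[of _ n]) (auto simp: vander_def)
  then obtain v where v: "v \<in> carrier_vec n" "v \<noteq> 0\<^sub>v n" "transpose_mat (vander n z) *\<^sub>v v = 0\<^sub>v n"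
    using det_0_iff_vec_prod_zero_field[of "transpose_mat (vander n z)" n] by (auto simp: vander_def)
  define p where "p = (\<Sum>k<n. Polynomial.monom (vec_index v k) k)"
  have coeff_p: "coeff p k = (if k < n then vec_index v k else 0)" for k
    by (auto simp: p_def coeff_sum)
  have "poly p (z c) = 0" if "c < n" for c
  proof -
    have "0 = vec_index (transpose_mat (vander n z) *\<^sub>v v) c"
      using v that by simp
    also have "\<dots> = (\<Sum>k<n. z c ^ k * vec_index v k)"
      using v(1) that by (simp add: vander_def scalar_prod_def atLeast0LessThan)
    also have "\<dots> = poly p (z c)"
      by (simp add: p_def poly_sum poly_monom mult.commute)
    finally show ?thesis by simp
  qed
  hence sub: "z ` {..<n} \<subseteq> {x. poly p x = 0}" by auto
  have "p \<noteq> 0"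
  proof
    assume "p = 0"
    hence "vec_index v k = 0" if "k < n" for k
      using coeff_p[of k] that by simp
    hence "v = 0\<^sub>v n" using v(1) by (intro eq_vecI) auto
    with v(2) show False by simp
  qed
  have "n = card (z ` {..<n})"
    using inj by (simp add: card_image)
  also have "\<dots> \<le> card {x. poly p x = 0}"
    by (rule card_mono[OF poly_roots_finite[OF \<open>p \<noteq> 0\<close>] sub])
  also have "\<dots> \<le> degree p"
    by (rule card_poly_roots_bound[OF \<open>p \<noteq> 0\<close>])
  finally have "n \<le> degree p" .
  moreover have "coeff p (degree p) \<noteq> 0" using \<open>p \<noteq> 0\<close> by simp
  ultimately show False using coeff_p[of "degree p"] by simp
qed

text \<open>Multiples of \<open>q\<close> come first and columns run by increasing degree, the order
  in which the block \<open>T\<close> of \<open>det_sylv\<close> is lower triangular. The ring is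
  left open so that one formula gives both the integer matrix and its complex image.\<close>

definition sylv :: "nat \<Rightarrow> nat \<Rightarrow> 'a :: comm_ring_1 poly \<Rightarrow> 'a poly \<Rightarrow> 'a mat" where
  "sylv n m p q = Matrix.mat (n + m) (n + m)
     (\<lambda>(i, k). coeff (if i < n then Polynomial.monom 1 i * q else Polynomial.monom 1 (i - n) * p) k)"

text \<open>Multiplying the Sylvester matrix by the evaluation matrix at the roots of \<open>p\<close>, completed by
  unit columns, kills the block of rows belonging to \<open>p\<close>.\<close>

lemma det_sylv:
  fixes p q :: "complex poly"
  assumes p: "degree p = n" and q: "degree q \<le> m"
    and inj: "inj_on z {..<n}" and root: "\<And>c. c < n \<Longrightarrow> poly p (z c) = 0"
  shows "Determinant.det (sylv n m p q) = lead_coeff p ^ m * (\<Prod>c<n. poly q (z c))"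
proof -
  define W where "W = Matrix.mat m n (\<lambda>(k, c). z c ^ (n + k))"
  \<comment> \<open>The first \<open>n\<close> columns evaluate the polynomial of a row at
    \<open>z c\<close>; the unit columns read off its coefficients of degree at least
    \<open>n\<close>.\<close>
  define E where "E = four_block_mat (vander n z) (0\<^sub>m n m) W (1\<^sub>m m)"
  define B where "B = Matrix.mat n m (\<lambda>(i, l). coeff (Polynomial.monom 1 i * q) (n + l))"
  define T where "T = Matrix.mat m m (\<lambda>(i, l). coeff (Polynomial.monom 1 i * p) (n + l))"
  define A where "A = Matrix.mat n n (\<lambda>(i, c). z c ^ i * poly q (z c))"
  define D where "D = Matrix.mat n n (\<lambda>(i, c). if i = c then poly q (z c) else 0)"
  have V: "vander n z \<in> carrier_mat n n" by (simp add: vander_def)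
  have W: "W \<in> carrier_mat m n" by (simp add: W_def)
  have E: "E \<in> carrier_mat (n + m) (n + m)" using V W by (simp add: E_def)
  have S: "sylv n m p q \<in> carrier_mat (n + m) (n + m)" by (simp add: sylv_def)
  have D: "D \<in> carrier_mat n n" by (simp add: D_def)
  have E_index: "E $$ (k, c) = (if c < n then z c ^ k else if k = c then 1 else 0)"
    if "k < n + m" "c < n + m" for k c
    using that V W by (auto simp: E_def vander_def W_def)
  have detE: "Determinant.det E = Determinant.det (vander n z)"
    unfolding E_def by (subst det_four_block_mat_upper_right_zero[OF V _ W]) auto
  have row_q: "(\<Sum>k<n + m. coeff (Polynomial.monom 1 i * q) k * x ^ k) = x ^ i * poly q x"
    if "i < n" for i x
    using q that by (subst poly_eq_sum_lessThan[symmetric])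
      (auto simp: coeff_monom_mult poly_monom intro!: coeff_eq_0)
  have row_p: "(\<Sum>k<n + m. coeff (Polynomial.monom 1 i * p) k * x ^ k) = x ^ i * poly p x"
    if "i < m" for i x
    using p that by (subst poly_eq_sum_lessThan[symmetric])
      (auto simp: coeff_monom_mult poly_monom intro!: coeff_eq_0)
  have "sylv n m p q * E = four_block_mat A B (0\<^sub>m m n) T" (is "_ = ?F")
  proof (rule eq_matI)
    fix i c assume "i < dim_row ?F" "c < dim_col ?F"
    hence ic: "i < n + m" "c < n + m" by (auto simp: A_def T_def)
    have "(sylv n m p q * E) $$ (i, c) = (\<Sum>k<n + m. sylv n m p q $$ (i, k) * E $$ (k, c))"
      using S E ic by (auto simp: scalar_prod_def atLeast0LessThan)
    also have "\<dots> = (\<Sum>k<n + m. coeff (if i < n then Polynomial.monom 1 i * q else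
        Polynomial.monom 1 (i - n) * p) k * (if c < n then z c ^ k else if k = c then 1 else 0))"
      using ic by (intro sum.cong refl) (simp add: E_index sylv_def)
    also have "\<dots> = ?F $$ (i, c)"
    proof (cases "c < n")
      case True
      thus ?thesis using ic row_q row_p root[of c]
        by (cases "i < n") (auto simp: A_def T_def B_def)
    next
      case False
      hence "(\<Sum>k<n + m. coeff (if i < n then Polynomial.monom 1 i * q else
        Polynomial.monom 1 (i - n) * p) k * (if c < n then z c ^ k else if k = c then 1 else 0)) =
        (\<Sum>k<n + m. if k = c then coeff (if i < n then Polynomial.monom 1 i * q else
        Polynomial.monom 1 (i - n) * p) k else 0)"
        by (intro sum.cong) auto
      thus ?thesis using ic False by (auto simp: A_def T_def B_def)
    qed
    finally show "(sylv n m p q * E) $$ (i, c) = ?F $$ (i, c)" .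
  qed (use S E in \<open>auto simp: A_def T_def\<close>)
  hence "Determinant.det (sylv n m p q) * Determinant.det E = Determinant.det A * Determinant.det T"
    by (subst det_mult[OF S E, symmetric], simp,
        subst det_four_block_mat_lower_left_zero) (auto simp: A_def B_def T_def)
  \<comment> \<open>Splitting off the Vandermonde matrix leaves the values of \<open>q\<close> on a
    diagonal; its determinant cancels against that of \<open>E\<close>.\<close>
  moreover have "A = vander n z * D"
  proof (rule eq_matI)
    fix i c assume "i < dim_row (vander n z * D)" "c < dim_col (vander n z * D)"
    hence ic: "i < n" "c < n" using V D by auto
    have "(vander n z * D) $$ (i, c) = (\<Sum>k<n. z k ^ i * (if k = c then poly q (z c) else 0))"
      using ic by (auto simp: vander_def D_def scalar_prod_def atLeast0LessThan)
    also have "\<dots> = (\<Sum>k<n. if k = c then z k ^ i * poly q (z c) else 0)"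
      by (intro sum.cong) auto
    finally show "A $$ (i, c) = (vander n z * D) $$ (i, c)"
      using ic by (simp add: A_def)
  qed (auto simp: A_def D_def vander_def)
  moreover have "Determinant.det D = (\<Prod>c<n. poly q (z c))"
    by (subst det_lower_triangular[of n])
      (auto simp: D_def diag_mat_def prod.list_conv_set_nth atLeast0LessThan intro!: prod.cong)
  \<comment> \<open>Row \<open>i\<close> of \<open>T\<close> is shifted by \<open>i\<close>, so
    entries right of the diagonal belong to degrees above \<open>n\<close>, and the diagonal carries
    the leading coefficient.\<close>
  moreover have "Determinant.det T = lead_coeff p ^ m"
    using p by (subst det_lower_triangular[of m])
      (auto simp: T_def diag_mat_def prod.list_conv_set_nth coeff_monom_mult coeff_eq_0)
  ultimately show ?thesis
    using detE det_vander_nonzero[OF inj] det_mult[OF V D] by (simp add: mult_ac)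
qed

text \<open>The number is the determinant of a Sylvester matrix with integer entries. The condition
  on \<open>card\<close> says that the zeros of \<open>p'\<close> are simple, as the evaluation at
  distinct points in \<open>det_sylv\<close> requires.\<close>

lemma resultant_in_Ints:
  fixes p q :: "int poly"
  defines "p' \<equiv> map_poly of_int p :: complex poly" and "q' \<equiv> map_poly of_int q :: complex poly"
  assumes "card {z. poly p' z = 0} = degree p" "degree q \<le> m" "p \<noteq> 0"
  shows "of_int (lead_coeff p) ^ m * (\<Prod>z | poly p' z = 0. poly q' z) \<in> \<int>"
proof -
  let ?n = "degree p" and ?Z = "{z. poly p' z = 0}"
  have deg: "degree p' = ?n" "degree q' = degree q"
    by (simp_all add: p'_def q'_def degree_map_poly)
  have "p' \<noteq> 0" using \<open>p \<noteq> 0\<close> by (auto simp: p'_def poly_eq_iff coeff_map_poly)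
  hence fin: "finite ?Z" by (rule poly_roots_finite)
  obtain z where "bij_betw z {0..<card ?Z} ?Z"
    using ex_bij_betw_nat_finite[OF fin] by blast
  hence z: "bij_betw z {..<?n} ?Z" using assms(3) by (simp add: atLeast0LessThan)
  have root: "poly p' (z c) = 0" if "c < ?n" for c
    using bij_betwE[OF z] that by auto
  have "sylv ?n m p' q' = map_mat of_int (sylv ?n m p q)"
    by (rule eq_matI) (auto simp: sylv_def p'_def q'_def coeff_map_poly coeff_monom_mult)
  hence "of_int (Determinant.det (sylv ?n m p q)) = Determinant.det (sylv ?n m p' q')"
    by simp
  also have "\<dots> = lead_coeff p' ^ m * (\<Prod>c<?n. poly q' (z c))"
    using assms(4) deg z root by (intro det_sylv) (auto dest: bij_betw_imp_inj_on)
  also have "(\<Prod>c<?n. poly q' (z c)) = (\<Prod>z\<in>?Z. poly q' z)"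
    using prod.reindex_bij_betw[OF z] .
  also have "lead_coeff p' = of_int (lead_coeff p)"
    by (simp add: deg) (simp add: p'_def coeff_map_poly)
  finally show ?thesis by (metis Ints_of_int)
qed

section \<open>Rotation invariance of the area measure\<close>

text \<open>The coordinate map pulls boxes back to boxes with the same side lengths, and boxes
  determine \<open>lborel\<close>. This carries facts about orthogonal maps of \<open>real^2\<close>
  over to the complex plane.\<close>

lemma lborel_complex_eq_distr:
  "(lborel :: complex measure) = distr (lborel :: (real^2) measure) borel (\<lambda>v. Complex (v $ 1) (v $ 2))"
proof (rule lborel_eqI)
  fix l u :: complex
  assume le: "\<And>b. b \<in> Basis \<Longrightarrow> l \<bullet> b \<le> u \<bullet> b"
  define h where "h = (\<lambda>z::complex. (\<chi> i::2. if i = 1 then Re z else Im z))"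
  have h: "h z $ 1 = Re z" "h z $ 2 = Im z" for z by (auto simp: h_def)
  have meas: "(\<lambda>v::real^2. Complex (v $ 1) (v $ 2)) \<in> borel_measurable borel"
    by (intro borel_measurable_continuous_onI) (auto intro!: continuous_intros simp: Complex_eq)
  have pre: "(\<lambda>v::real^2. Complex (v $ 1) (v $ 2)) -` box l u = box (h l) (h u)"
    by (auto simp: mem_box_cart forall_2 h mem_box Basis_complex_def)
  have le': "Re l \<le> Re u" "Im l \<le> Im u"
    using le[of 1] le[of \<i>] by (auto simp: Basis_complex_def)
  have "emeasure (distr lborel borel (\<lambda>v::real^2. Complex (v $ 1) (v $ 2))) (box l u) =
      emeasure lborel (box (h l) (h u))"
    using meas pre by (subst emeasure_distr) auto
  also have "\<dots> = ennreal (measure lborel (cbox (h l) (h u)))"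
    by (simp add: emeasure_lborel_box_eq emeasure_lborel_cbox_eq measure_def)
  also have "measure lborel (cbox (h l) (h u)) = (\<Prod>i\<in>UNIV. h u $ i - h l $ i)"
    by (rule content_cbox_cart) (use le' in \<open>auto simp: interval_ne_empty_cart forall_2 h\<close>)
  also have "\<dots> = (\<Prod>b\<in>Basis. (u - l) \<bullet> b)"
    by (simp add: UNIV_2 h Basis_complex_def)
  finally show "emeasure (distr lborel borel (\<lambda>v::real^2. Complex (v $ 1) (v $ 2))) (box l u) =
      (\<Prod>b\<in>Basis. (u - l) \<bullet> b)" .
qed auto

lemma lborel_distr_complex_rotation:
  fixes \<zeta> :: complex
  assumes "cmod \<zeta> = 1"
  shows "distr lborel borel ((*) \<zeta>) = lborel"
proof (rule lborel_eqI[symmetric])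
  fix l u :: complex
  assume le: "\<And>b. b \<in> Basis \<Longrightarrow> l \<bullet> b \<le> u \<bullet> b"
  define g where "g = (\<lambda>v::real^2. Complex (v $ 1) (v $ 2))"
  define h where "h = (\<lambda>z::complex. (\<chi> i::2. if i = 1 then Re z else Im z))"
  have gh: "g (h z) = z" and hg: "h (g v) = v" for z v
    by (auto simp: g_def h_def Finite_Cartesian_Product.vec_eq_iff forall_2)
  have norm_g: "cmod (g v) = norm v" for v
    by (simp add: g_def cmod_def norm_vec_def L2_set_def sum_2)
  have g_lin: "g (a + b) = g a + g b" "g (c *\<^sub>R a) = c *\<^sub>R g a" for a b c
    by (auto simp: g_def complex_eq_iff)
  have h_lin: "h (a + b) = h a + h b" "h (c *\<^sub>R a) = c *\<^sub>R h a" for a b c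
    by (auto simp: h_def Finite_Cartesian_Product.vec_eq_iff)
  have meas_g [measurable]: "g \<in> borel_measurable borel"
    unfolding g_def
    by (intro borel_measurable_continuous_onI) (auto intro!: continuous_intros simp: Complex_eq)
  have "\<zeta> \<noteq> 0" using assms by auto
  have div_scaleR: "(c *\<^sub>R x) / \<zeta> = c *\<^sub>R (x / \<zeta>)" for c x
    by (simp add: scaleR_conv_of_real)
  \<comment> \<open>Division rather than multiplication by \<zeta>: the preimage of a box under the
    rotation is its image under the inverse rotation.\<close>
  define f where "f = (\<lambda>v. h (g v / \<zeta>))"
  have f: "orthogonal_transformation f"
    unfolding orthogonal_transformation
  proof
    show "linear f"
      by (intro linearI) (simp_all only: f_def g_lin h_lin add_divide_distrib div_scaleR)
    have "norm (f v) = norm v" for v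
      using assms by (simp add: f_def gh norm_divide flip: norm_g)
    thus "\<forall>v. norm (f v) = norm v" by blast
  qed
  have eq: "g -` ((*) \<zeta> -` box l u) = f ` (g -` box l u)"
  proof (intro equalityI subsetI)
    fix v assume "v \<in> g -` ((*) \<zeta> -` box l u)"
    moreover have "v = f (h (\<zeta> * g v))" using \<open>\<zeta> \<noteq> 0\<close> by (simp add: f_def gh hg)
    ultimately show "v \<in> f ` (g -` box l u)" by (auto simp: gh intro!: image_eqI)
  qed (use \<open>\<zeta> \<noteq> 0\<close> in \<open>auto simp: f_def gh\<close>)
  have lborel: "lborel = distr lborel borel g"
    unfolding g_def by (rule lborel_complex_eq_distr)
  have S: "g -` A \<in> sets borel" if "A \<in> sets borel" for A
    using measurable_sets[OF meas_g that] by simp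
  have e: "emeasure lborel A = emeasure lborel (g -` A)" if "A \<in> sets borel" for A
    using that by (subst lborel, subst emeasure_distr) auto
  have rot: "(*) \<zeta> -` box l u \<in> sets borel"
    using measurable_sets[of "(*) \<zeta>" borel borel "box l u"] by simp
  have fin: "emeasure lborel (g -` box l u) < \<infinity>"
    by (subst e[symmetric]) (auto simp: emeasure_lborel_box_eq)
  have lm: "g -` box l u \<in> lmeasurable"
    using S[of "box l u"] fin by (auto simp: fmeasurable_def sets_completionI_sets)
  have "emeasure (distr lborel borel ((*) \<zeta>)) (box l u) = emeasure lborel (f ` (g -` box l u))"
    using rot by (subst emeasure_distr) (auto simp: e eq)
  also have "\<dots> = emeasure lebesgue (f ` (g -` box l u))"
    using S[OF rot] eq by (simp)
  also have "\<dots> = emeasure lebesgue (g -` box l u)"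
    by (simp only: emeasure_eq_measure2 lm measurable_orthogonal_image[OF f lm]
        measure_orthogonal_image[OF f lm])
  also have "\<dots> = emeasure lborel (box l u)"
    using S[of "box l u"] by (simp add: e)
  finally show "emeasure (distr lborel borel ((*) \<zeta>)) (box l u) = (\<Prod>b\<in>Basis. (u - l) \<bullet> b)"
    using le by (simp add: emeasure_lborel_box_eq)
qed simp

section \<open>Logarithmic integrals over the unit disk\<close>

text \<open>Polar coordinates, reduced to what radial integrands need: for \<open>x\<close> between
  0 and 1 both measures give the ray above \<open>x\<close> the mass
  \<open>pi * (1 - x\<^sup>2)\<close>, the area of an annulus.\<close>

lemma distr_norm_unit_disk:
  "distr (density lborel (indicator (ball (0::complex) 1))) borel norm =
     density lborel (\<lambda>r. ennreal (indicator {0..1} r * (2 * pi * r)))"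
  (is "?M = ?N")
proof (rule measure_eqI_lessThan)
  have M: "emeasure ?M {x<..} = emeasure lborel (ball (0::complex) 1 \<inter> {z. x < norm z})" for x :: real
  proof -
    have "emeasure ?M {x<..} =
        emeasure (density lborel (indicator (ball (0::complex) 1))) {z. x < norm z}"
      by (subst emeasure_distr) (auto simp: vimage_def)
    also have "\<dots> = (\<integral>\<^sup>+z. indicator (ball (0::complex) 1) z * indicator {z. x < norm z} z \<partial>lborel)"
      by (subst emeasure_density) (auto intro!: borel_measurable_indicator)
    also have "\<dots> = (\<integral>\<^sup>+z. indicator (ball (0::complex) 1 \<inter> {z. x < norm z}) z \<partial>lborel)"
      unfolding indicator_inter_arith ..
    also have "\<dots> = emeasure lborel (ball (0::complex) 1 \<inter> {z. x < norm z})"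
      by (subst nn_integral_indicator) auto
    finally show ?thesis .
  qed
  have disk: "emeasure lborel (ball (0::complex) 1) = ennreal pi"
    by (subst emeasure_ball) (auto simp: unit_ball_vol_2)
  show "emeasure ?M {x<..} < \<infinity>" for x :: real
  proof -
    have "emeasure ?M {x<..} \<le> emeasure lborel (ball (0::complex) 1)"
      unfolding M by (rule emeasure_mono) auto
    also have "\<dots> < \<infinity>" by (simp add: disk)
    finally show ?thesis .
  qed
  have N: "emeasure ?N {x<..} = (\<integral>\<^sup>+r. ennreal (2 * pi * r) * indicator {x..1} r \<partial>lborel)"
    if "x \<ge> 0" for x :: real
  proof -
    have "emeasure ?N {x<..} = (\<integral>\<^sup>+r. ennreal (indicator {0..1} r * (2 * pi * r)) * indicator {x<..} r \<partial>lborel)"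
      by (subst emeasure_density) auto
    also have "\<dots> = (\<integral>\<^sup>+r. ennreal (2 * pi * r) * indicator {x..1} r \<partial>lborel)"
    proof (rule nn_integral_cong_AE)
      show "AE r in lborel. ennreal (indicator {0..1} r * (2 * pi * r)) * indicator {x<..} r =
          ennreal (2 * pi * r) * indicator {x..1} r"
        using AE_lborel_singleton[of x] by eventually_elim (use that in \<open>auto simp: indicator_def\<close>)
    qed
    finally show ?thesis .
  qed
  have N1: "emeasure ?N {x<..} = ennreal (pi * (1 - x\<^sup>2))" if "0 \<le> x" "x \<le> 1" for x :: real
  proof -
    have "emeasure ?N {x<..} = ennreal (pi * 1\<^sup>2 - pi * x\<^sup>2)"
      unfolding N[OF that(1)]
      by (rule nn_integral_FTC_Icc) (use that in \<open>auto intro!: derivative_eq_intros\<close>)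
    thus ?thesis by (simp add: algebra_simps)
  qed
  fix x :: real
  consider "x < 0" | "0 \<le> x" "x \<le> 1" | "x > 1" by linarith
  thus "emeasure ?M {x<..} = emeasure ?N {x<..}"
  proof cases
    case 1
    hence *: "ball (0::complex) 1 \<inter> {z. x < norm z} = ball 0 1"
      by (auto intro: less_le_trans[OF _ norm_ge_zero])
    have "emeasure ?N {x<..} = emeasure ?N {0<..}"
      using 1 by (subst (1 2) emeasure_density, simp_all, intro nn_integral_cong_AE)
        (use AE_lborel_singleton[of 0] in \<open>auto elim!: eventually_mono simp: indicator_def\<close>)
    also have "\<dots> = ennreal pi" using N1[of 0] by simp
    finally show ?thesis by (simp add: M disk *)
  next
    case 2
    have "ball (0::complex) 1 \<inter> {z. x < norm z} = ball 0 1 - cball 0 x" by auto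
    also have "emeasure lborel \<dots> = emeasure lborel (ball (0::complex) 1 - ball 0 x - sphere 0 x)"
      by (intro arg_cong2[of _ _ _ _ emeasure]) auto
    also have "\<dots> = emeasure lborel (ball (0::complex) 1 - ball 0 x)"
      using negligible_sphere[of "0::complex" x]
      by (intro emeasure_Diff_null_set)
         (auto simp: null_sets_completion_iff negligible_iff_null_sets negligible_convex_frontier)
    also have "\<dots> = emeasure lborel (ball (0::complex) 1) - emeasure lborel (ball (0::complex) x)"
      using 2 by (intro emeasure_Diff) (auto simp: emeasure_ball)
    also have "\<dots> = ennreal pi - ennreal (pi * x\<^sup>2)"
      using 2 by (simp add: emeasure_ball unit_ball_vol_2)
    also have "\<dots> = ennreal (pi * (1 - x\<^sup>2))"
      using 2 by (subst ennreal_minus) (auto simp: algebra_simps)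
    finally show ?thesis using N1[OF 2] by (simp add: M)
  next
    case 3
    hence *: "ball (0::complex) 1 \<inter> {z. x < norm z} = {}" by auto
    show ?thesis using 3 unfolding M * by (subst N) auto
  qed
qed auto

lemma
  fixes g :: "real \<Rightarrow> real"
  assumes [measurable]: "g \<in> borel_measurable borel"
  shows set_integrable_radial_iff:
      "set_integrable lborel (ball (0::complex) 1) (\<lambda>z. g (cmod z)) \<longleftrightarrow>
         set_integrable lborel {0..1} (\<lambda>r. r * g r)"
    and set_lebesgue_integral_radial:
      "(LINT z:ball (0::complex) 1|lborel. g (cmod z)) = 2 * pi * (LINT r:{0..1}|lborel. r * g r)"
proof -
  have ind: "density lborel (indicator (ball (0::complex) 1)) =
      density lborel (\<lambda>z. ennreal (indicator (ball 0 1) z))"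
    by (simp add: ennreal_indicator)
  have [measurable]: "indicat_real (ball (0::complex) 1) \<in> borel_measurable borel"
    by (intro borel_measurable_indicator) auto
  have "set_integrable lborel (ball (0::complex) 1) (\<lambda>z. g (cmod z)) \<longleftrightarrow>
      integrable (density lborel (indicator (ball (0::complex) 1))) (\<lambda>z. g (cmod z))"
    unfolding set_integrable_def ind by (subst integrable_density) auto
  also have "\<dots> \<longleftrightarrow> integrable (distr (density lborel (indicator (ball (0::complex) 1))) borel norm) g"
    by (subst integrable_distr_eq) auto
  also have "\<dots> \<longleftrightarrow> integrable lborel (\<lambda>r. (2 * pi) * (indicator {0..1} r *\<^sub>R (r * g r)))"
    unfolding distr_norm_unit_disk
    by (subst integrable_density) (auto simp: indicator_def mult_ac)
  also have "\<dots> \<longleftrightarrow> set_integrable lborel {0..1} (\<lambda>r. r * g r)"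
    unfolding set_integrable_def by simp
  finally show "set_integrable lborel (ball (0::complex) 1) (\<lambda>z. g (cmod z)) \<longleftrightarrow>
         set_integrable lborel {0..1} (\<lambda>r. r * g r)" .
  have "(LINT z:ball (0::complex) 1|lborel. g (cmod z)) =
      (LINT z|density lborel (indicator (ball (0::complex) 1)). g (cmod z))"
    unfolding set_lebesgue_integral_def ind by (subst integral_density) auto
  also have "\<dots> = integral\<^sup>L (distr (density lborel (indicator (ball (0::complex) 1))) borel norm) g"
    by (subst integral_distr) auto
  also have "\<dots> = (LINT r|lborel. (2 * pi) * (indicator {0..1} r *\<^sub>R (r * g r)))"
    unfolding distr_norm_unit_disk
    by (subst integral_density) (auto simp: indicator_def mult_ac)
  also have "\<dots> = 2 * pi * (LINT r:{0..1}|lborel. r * g r)"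
    unfolding set_lebesgue_integral_def by (subst integral_mult_right_zero) auto
  finally show "(LINT z:ball (0::complex) 1|lborel. g (cmod z)) =
      2 * pi * (LINT r:{0..1}|lborel. r * g r)" .
qed

text \<open>The bound of \<open>ln\<close> by the identity, applied to \<open>s\<close> and to
  \<open>s powr (-1/2)\<close>; the exponent keeps the majorant integrable at 0. At
  \<open>s = 0\<close> both sides are 0 by convention.\<close>

lemma abs_ln_le_powr:
  fixes s :: real
  assumes "s \<ge> 0"
  shows "\<bar>ln s\<bar> \<le> 2 * s powr (-1/2) + s"
proof (cases "s = 0")
  case False
  with assms have s: "s > 0" by simp
  have "ln s \<le> s" using ln_le_minus_one[OF s] by simp
  moreover have "ln (s powr (-1/2)) \<le> s powr (-1/2)"
    using ln_le_minus_one[of "s powr (-1/2)"] s by simp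
  hence "- ln s \<le> 2 * s powr (-1/2)" using s by (simp add: ln_powr)
  moreover have "s powr (-1/2) \<ge> 0" by simp
  ultimately show ?thesis using s by linarith
qed simp

lemma set_integrable_ln_dist:
  fixes \<rho> :: real
  assumes "\<rho> \<ge> 0"
  shows "set_integrable lborel {0..1} (\<lambda>r. ln \<bar>r - \<rho>\<bar>)"
proof -
  \<comment> \<open>A one-sided singularity at 0; its translate and its reflected translate together
    dominate \<open>\<bar>r - \<rho>\<bar> powr (-1/2)\<close> on both sides of \<rho>.\<close>
  define \<phi> where "\<phi> = (\<lambda>x::real. indicator {0..1 + \<rho>} x * x powr (-1/2))"
  have [measurable]: "\<phi> \<in> borel_measurable borel" by (simp add: \<phi>_def)
  have "(\<lambda>x::real. x powr (-1/2)) integrable_on {0..1 + \<rho>}"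
    using assms by (intro integrable_on_powr_from_0) auto
  hence "(\<lambda>x::real. x powr (-1/2)) absolutely_integrable_on {0..1 + \<rho>}"
    by (subst absolutely_integrable_on_iff_nonneg) auto
  hence \<phi>: "integrable lborel \<phi>"
    unfolding set_integrable_def by (subst (asm) integrable_completion) (auto simp: \<phi>_def)
  have "integrable lborel (\<lambda>r. \<phi> (-\<rho> + 1 * r))" "integrable lborel (\<lambda>r. \<phi> (\<rho> + (-1) * r))"
    by (rule lborel_integrable_real_affine[OF \<phi>]; simp)+
  hence "integrable lborel (\<lambda>r. 2 * (\<phi> (-\<rho> + 1 * r) + \<phi> (\<rho> + (-1) * r)) + (1 + \<rho>) * indicator {0..1} r)"
    by (intro Bochner_Integration.integrable_add integrable_mult_right) auto
  thus ?thesis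
    unfolding set_integrable_def
  proof (rule Bochner_Integration.integrable_bound)
    show "AE r in lborel. norm (indicator {0..1} r *\<^sub>R ln \<bar>r - \<rho>\<bar>) \<le>
        norm (2 * (\<phi> (-\<rho> + 1 * r) + \<phi> (\<rho> + (-1) * r)) + (1 + \<rho>) * indicator {0..1} r)"
    proof (rule AE_I2)
      fix r :: real
      have nonneg: "\<phi> x \<ge> 0" for x by (simp add: \<phi>_def)
      show "norm (indicator {0..1} r *\<^sub>R ln \<bar>r - \<rho>\<bar>) \<le>
        norm (2 * (\<phi> (-\<rho> + 1 * r) + \<phi> (\<rho> + (-1) * r)) + (1 + \<rho>) * indicator {0..1} r)"
      proof (cases "r \<in> {0..1}")
        case True
        have "\<bar>r - \<rho>\<bar> powr (-1/2) \<le> \<phi> (-\<rho> + 1 * r) + \<phi> (\<rho> + (-1) * r)"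
          using True assms by (cases "r \<ge> \<rho>") (auto simp: \<phi>_def)
        moreover have "\<bar>r - \<rho>\<bar> \<le> 1 + \<rho>" using True assms by auto
        ultimately show ?thesis
          using abs_ln_le_powr[of "\<bar>r - \<rho>\<bar>"] True by simp
      qed (use nonneg in simp)
    qed
  qed simp
qed

lemma set_integrable_disk_ln_dist:
  fixes \<rho> :: real
  assumes "\<rho> \<ge> 0"
  shows "set_integrable lborel (ball (0::complex) 1) (\<lambda>z. ln \<bar>cmod z - \<rho>\<bar>)"
proof (subst set_integrable_radial_iff)
  show "set_integrable lborel {0..1} (\<lambda>r. r * ln \<bar>r - \<rho>\<bar>)"
    by (rule set_integrable_bound[OF set_integrable_ln_dist[OF assms]])
       (auto simp: set_borel_measurable_def abs_mult intro!: mult_left_le_one_le)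
qed simp

text \<open>The antiderivative is \<open>r\<^sup>2 / 2 * ln r - r\<^sup>2 / 4\<close>. Only the
  endpoint 0 needs care: there the convention \<open>ln 0 = 0\<close> gives it the value 0, which is
  also its limit.\<close>

lemma has_integral_r_ln:
  assumes "0 \<le> \<rho>" "\<rho> \<le> 1"
  shows "((\<lambda>r::real. r * ln r) has_integral (- 1/4 - (\<rho>\<^sup>2 / 2 * ln \<rho> - \<rho>\<^sup>2 / 4))) {\<rho>..1}"
proof -
  have lim: "((\<lambda>r::real. r\<^sup>2 / 2 * ln r - r\<^sup>2 / 4) \<longlongrightarrow> 0) (at_right 0)"
    by real_asymp
  have cont: "continuous_on {\<rho>..1} (\<lambda>r::real. r\<^sup>2 / 2 * ln r - r\<^sup>2 / 4)"
    unfolding continuous_on_eq_continuous_within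
  proof
    fix x :: real assume x: "x \<in> {\<rho>..1}"
    show "continuous (at x within {\<rho>..1}) (\<lambda>r::real. r\<^sup>2 / 2 * ln r - r\<^sup>2 / 4)"
    proof (cases "x = 0")
      case True
      have "((\<lambda>r::real. r\<^sup>2 / 2 * ln r - r\<^sup>2 / 4) \<longlongrightarrow> 0) (at 0 within {\<rho>..1})"
        by (rule tendsto_mono[OF _ lim])
           (use assms in \<open>auto simp: at_within_def intro!: le_infI2\<close>)
      thus ?thesis by (simp add: continuous_within True)
    qed (use x assms in \<open>auto intro!: continuous_intros\<close>)
  qed
  have "((\<lambda>r::real. r * ln r) has_integral
      ((1::real)\<^sup>2 / 2 * ln 1 - 1\<^sup>2 / 4) - (\<rho>\<^sup>2 / 2 * ln \<rho> - \<rho>\<^sup>2 / 4)) {\<rho>..1}"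
    using assms
    by (intro fundamental_theorem_of_calculus_interior cont)
       (auto intro!: derivative_eq_intros simp flip: has_real_derivative_iff_has_vector_derivative
         simp: power2_eq_square add_divide_distrib)
  thus ?thesis by simp
qed

text \<open>By Jensen's formula \<open>ln (max (cmod z) \<rho>)\<close> is the mean of
  \<open>ln (cmod (z - w))\<close> over the rotations of \<open>z\<close>, where
  \<open>\<rho> = cmod w\<close>. The integral is therefore the sharp constant for
  \<open>set_integral_disk_ln_norm_diff_ge\<close>.\<close>

lemma
  fixes \<rho> :: real
  assumes "\<rho> \<ge> 0"
  shows set_integrable_disk_ln_max:
      "set_integrable lborel (ball (0::complex) 1) (\<lambda>z. ln (max (cmod z) \<rho>))"
    and set_integral_disk_ln_max:
      "(LINT z:ball (0::complex) 1|lborel. ln (max (cmod z) \<rho>)) =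
         pi * (if \<rho> \<ge> 1 then ln \<rho> else (\<rho>\<^sup>2 - 1) / 2)"
proof -
  have int0: "set_integrable lborel {0..1} (\<lambda>r::real. \<bar>ln \<bar>r - 0\<bar>\<bar> + \<bar>ln (max 1 \<rho>)\<bar>)"
    by (intro set_integral_add set_integrable_abs set_integrable_ln_dist)
       (auto simp: set_integrable_def)
  have int: "set_integrable lborel {0..1} (\<lambda>r. r * ln (max r \<rho>))"
  proof (rule set_integrable_bound[OF int0])
    have "\<bar>r * ln (max r \<rho>)\<bar> \<le> \<bar>ln \<bar>r - 0\<bar>\<bar> + \<bar>ln (max 1 \<rho>)\<bar>" if "0 \<le> r" "r \<le> 1" for r
    proof (cases "r = 0")
      case False
      hence "ln r \<le> ln (max r \<rho>)" "ln (max r \<rho>) \<le> ln (max 1 \<rho>)"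
        using that by auto
      hence "\<bar>ln (max r \<rho>)\<bar> \<le> \<bar>ln \<bar>r - 0\<bar>\<bar> + \<bar>ln (max 1 \<rho>)\<bar>"
        using that unfolding diff_zero by linarith
      moreover have "\<bar>r * ln (max r \<rho>)\<bar> \<le> \<bar>ln (max r \<rho>)\<bar>"
        using that by (simp add: abs_mult mult_left_le_one_le)
      ultimately show ?thesis by linarith
    qed simp
    thus "AE r in lborel. r \<in> {0..1} \<longrightarrow>
        norm (r * ln (max r \<rho>)) \<le> norm (\<bar>ln \<bar>r - 0\<bar>\<bar> + \<bar>ln (max 1 \<rho>)\<bar>)" by auto
  qed (simp add: set_borel_measurable_def)
  thus "set_integrable lborel (ball (0::complex) 1) (\<lambda>z. ln (max (cmod z) \<rho>))"
    by (subst set_integrable_radial_iff) auto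
  have "((\<lambda>r. r * ln (max r \<rho>)) has_integral
      (if \<rho> \<ge> 1 then ln \<rho> / 2 else (\<rho>\<^sup>2 - 1) / 4)) {0..1}"
  proof (cases "\<rho> \<ge> 1")
    case True
    have "((\<lambda>r. r * ln \<rho>) has_integral 1\<^sup>2 / 2 * ln \<rho> - 0\<^sup>2 / 2 * ln \<rho>) {0..1}"
      by (rule fundamental_theorem_of_calculus)
         (auto intro!: derivative_eq_intros simp flip: has_real_derivative_iff_has_vector_derivative)
    thus ?thesis using True by (subst has_integral_cong[of _ _ "\<lambda>r. r * ln \<rho>"]) auto
  next
    case False
    have "((\<lambda>r. r * ln \<rho>) has_integral \<rho>\<^sup>2 / 2 * ln \<rho> - 0\<^sup>2 / 2 * ln \<rho>) {0..\<rho>}"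
      by (rule fundamental_theorem_of_calculus)
         (use assms in \<open>auto intro!: derivative_eq_intros simp flip: has_real_derivative_iff_has_vector_derivative\<close>)
    hence 1: "((\<lambda>r. r * ln (max r \<rho>)) has_integral \<rho>\<^sup>2 / 2 * ln \<rho>) {0..\<rho>}"
      by (subst has_integral_cong[of _ _ "\<lambda>r. r * ln \<rho>"]) (auto simp: max_def)
    have 2: "((\<lambda>r. r * ln (max r \<rho>)) has_integral (- 1/4 - (\<rho>\<^sup>2 / 2 * ln \<rho> - \<rho>\<^sup>2 / 4))) {\<rho>..1}"
      using has_integral_r_ln[of \<rho>] False assms
      by (subst has_integral_cong[of _ _ "\<lambda>r. r * ln r"]) (auto simp: max_def)
    show ?thesis
      using has_integral_combine[OF _ _ 1 2] False assms by (simp add: field_simps)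
  qed
  moreover have "(LINT r:{0..1}|lborel. r * ln (max r \<rho>)) = integral {0..1} (\<lambda>r. r * ln (max r \<rho>))"
    by (rule set_borel_integral_eq_integral(2)[OF int])
  ultimately have "(LINT r:{0..1}|lborel. r * ln (max r \<rho>)) =
      (if \<rho> \<ge> 1 then ln \<rho> / 2 else (\<rho>\<^sup>2 - 1) / 4)"
    by (simp add: integral_unique)
  thus "(LINT z:ball (0::complex) 1|lborel. ln (max (cmod z) \<rho>)) =
         pi * (if \<rho> \<ge> 1 then ln \<rho> else (\<rho>\<^sup>2 - 1) / 2)"
    by (subst set_lebesgue_integral_radial[where g = "\<lambda>r. ln (max r \<rho>)"]) auto
qed

section \<open>Averages over rotations by roots of unity\<close>

lemma AE_norm_neq: "AE z in lborel. cmod z \<noteq> \<rho>"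
proof -
  have "sphere (0::complex) \<rho> \<in> null_sets lborel"
    using negligible_sphere[of "0::complex" \<rho>]
    by (auto simp: null_sets_completion_iff negligible_iff_null_sets negligible_convex_frontier)
  hence "AE z in lborel. z \<notin> sphere (0::complex) \<rho>" by (rule AE_not_in)
  thus ?thesis by eventually_elim auto
qed

lemma prod_unity_roots:
  fixes x w :: complex
  assumes "N > 0"
  shows "(\<Prod>\<zeta> | \<zeta> ^ N = 1. x - \<zeta> * w) = x ^ N - w ^ N"
proof -
  have card: "card {\<zeta>::complex. \<zeta> ^ N = 1} = N"
    using assms by (intro card_roots_unity_eq) auto
  define p :: "complex poly" where "p = Polynomial.monom 1 N - 1"
  have poly_p: "poly p y = y ^ N - 1" for y by (simp add: p_def poly_monom)
  have coeff_p: "coeff p k = (if k = N then 1 else 0) - (if k = 0 then 1 else 0)" for k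
    by (simp add: p_def)
  have deg: "degree p = N"
    by (rule antisym) (use assms coeff_p in \<open>auto intro!: degree_le le_degree\<close>)
  have "rsquarefree p"
    unfolding rsquarefree_roots
  proof (intro allI notI)
    fix a assume "poly p a = 0 \<and> poly (pderiv p) a = 0"
    moreover have "poly (pderiv p) a = of_nat N * a ^ (N - 1)"
      by (simp add: p_def pderiv_diff pderiv_monom poly_monom)
    ultimately have a: "a ^ N = 1" "a = 0" using assms by (auto simp: poly_p)
    thus False using a assms by (simp add: zero_power)
  qed
  hence decomp: "Polynomial.smult (lead_coeff p) (\<Prod>z | poly p z = 0. [:-z, 1:]) = p"
    by (rule complex_poly_decompose_rsquarefree)
  have "lead_coeff p = 1" using deg coeff_p[of N] assms by simp
  hence "poly p y = poly (\<Prod>z | poly p z = 0. [:-z, 1:]) y" for y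
    using decomp by (metis Polynomial.smult_1_left)
  hence "poly p y = (\<Prod>\<zeta> | \<zeta> ^ N = 1. y - \<zeta>)" for y
    by (simp add: poly_prod poly_p)
  hence prod: "(\<Prod>\<zeta> | \<zeta> ^ N = 1. y - \<zeta>) = y ^ N - 1" for y :: complex
    by (simp flip: poly_p)
  show ?thesis
  proof (cases "w = 0")
    case True
    thus ?thesis using assms card by simp
  next
    case False
    have "(\<Prod>\<zeta> | \<zeta> ^ N = 1. x - \<zeta> * w) = (\<Prod>\<zeta> | \<zeta> ^ N = 1. w * (x / w - \<zeta>))"
    proof (rule prod.cong[OF refl])
      show "x - \<zeta> * w = w * (x / w - \<zeta>)" for \<zeta>
        using False by (simp add: right_diff_distrib)
    qed
    also have "\<dots> = w ^ N * ((x / w) ^ N - 1)"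
      by (simp only: prod.distrib prod_constant card prod)
    also have "\<dots> = x ^ N - w ^ N"
      using False by (simp add: right_diff_distrib power_divide)
    finally show ?thesis .
  qed
qed

text \<open>For \<open>0 \<le> b \<le> a\<close> one has \<open>b ^ N \<le> a ^ (N - 1) * b\<close>.
  The bound degenerates only at equal moduli, through a factor that does not depend on
  \<open>N\<close> and has an integrable logarithm.\<close>

lemma norm_diff_powers_ge:
  fixes z w :: complex
  assumes "N > 0"
  shows "max (cmod z) (cmod w) ^ (N - 1) * \<bar>cmod z - cmod w\<bar> \<le> cmod (w ^ N - z ^ N)"
proof -
  have *: "a ^ (N - 1) * (a - b) \<le> a ^ N - b ^ N" if "0 \<le> b" "b \<le> a" for a b :: real
  proof -
    have "b ^ (N - 1) * b \<le> a ^ (N - 1) * b"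
      using that by (intro mult_right_mono power_mono)
    moreover have "x ^ N = x ^ (N - 1) * x" for x :: real
      using assms by (cases N) auto
    ultimately show ?thesis by (simp add: algebra_simps)
  qed
  have "max (cmod z) (cmod w) ^ (N - 1) * \<bar>cmod z - cmod w\<bar> \<le> \<bar>cmod w ^ N - cmod z ^ N\<bar>"
    using *[of "cmod z" "cmod w"] *[of "cmod w" "cmod z"]
    by (cases "cmod z \<le> cmod w") (auto simp: max_def)
  also have "\<dots> \<le> cmod (w ^ N - z ^ N)"
    using norm_triangle_ineq3[of "w ^ N" "z ^ N"] by (simp add: norm_power)
  finally show ?thesis .
qed

lemma set_integral_disk_rotate:
  fixes f :: "complex \<Rightarrow> real" and \<zeta> :: complex
  assumes [measurable]: "f \<in> borel_measurable borel" and "cmod \<zeta> = 1"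
  shows "(LINT z:ball 0 1|lborel. f (\<zeta> * z)) = (LINT z:ball 0 1|lborel. f z)"
proof -
  have [measurable]: "indicat_real (ball (0::complex) 1) \<in> borel_measurable borel"
    by (intro borel_measurable_indicator) auto
  have "(LINT z:ball 0 1|lborel. f z) =
      (LINT z|distr lborel borel ((*) \<zeta>). indicator (ball 0 1) z *\<^sub>R f z)"
    unfolding set_lebesgue_integral_def lborel_distr_complex_rotation[OF assms(2)] ..
  also have "\<dots> = (LINT z|lborel. indicator (ball 0 1) (\<zeta> * z) *\<^sub>R f (\<zeta> * z))"
    by (subst integral_distr) auto
  also have "(\<lambda>z. indicat_real (ball 0 1) (\<zeta> * z)) = indicat_real (ball 0 1)"
    using assms(2) by (auto simp: indicator_def norm_mult fun_eq_iff)
  finally show ?thesis by (simp add: set_lebesgue_integral_def)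
qed

text \<open>The reverse triangle inequality bounds the logarithm from below by a radial function, so
  the singularity at \<open>w\<close> reduces to a one-dimensional one in the modulus. From above
  the integrand is bounded on the disk.\<close>

lemma set_integrable_disk_ln_norm_diff:
  "set_integrable lborel (ball (0::complex) 1) (\<lambda>z. ln (cmod (z - w)))"
proof -
  let ?\<rho> = "cmod w"
  have "set_integrable lborel (ball (0::complex) 1) (\<lambda>z. \<bar>ln \<bar>cmod z - ?\<rho>\<bar>\<bar> + (1 + ?\<rho>))"
    by (intro set_integral_add set_integrable_abs set_integrable_disk_ln_dist)
       (auto simp: set_integrable_def emeasure_ball)
  thus ?thesis
  proof (rule set_integrable_bound)
    show "AE z in lborel. z \<in> ball 0 1 \<longrightarrow>
        norm (ln (cmod (z - w))) \<le> norm (\<bar>ln \<bar>cmod z - ?\<rho>\<bar>\<bar> + (1 + ?\<rho>))"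
      using AE_norm_neq[of ?\<rho>]
    proof eventually_elim
      case (elim z)
      show ?case
      proof
        assume z: "z \<in> ball 0 1"
        have "\<bar>cmod z - ?\<rho>\<bar> \<le> cmod (z - w)" by (rule norm_triangle_ineq3)
        moreover have pos: "\<bar>cmod z - ?\<rho>\<bar> > 0" using elim by simp
        ultimately have 1: "ln \<bar>cmod z - ?\<rho>\<bar> \<le> ln (cmod (z - w))"
          by (subst ln_le_cancel_iff) auto
        have "cmod (z - w) > 0" using elim by auto
        from ln_le_minus_one[OF this] have "ln (cmod (z - w)) \<le> 1 + ?\<rho>"
          using z norm_triangle_ineq4[of z w] by simp
        with 1 have "\<bar>ln (cmod (z - w))\<bar> \<le> \<bar>ln \<bar>cmod z - ?\<rho>\<bar>\<bar> + (1 + ?\<rho>)"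
          using norm_ge_zero[of w] by linarith
        thus "norm (ln (cmod (z - w))) \<le> norm (\<bar>ln \<bar>cmod z - ?\<rho>\<bar>\<bar> + (1 + ?\<rho>))" by simp
      qed
    qed
  next
    show "set_borel_measurable lborel (ball 0 1) (\<lambda>z. ln (cmod (z - w)))"
      unfolding set_borel_measurable_def
      by (intro borel_measurable_scaleR borel_measurable_indicator) auto
  qed
qed

text \<open>Averaging over the rotations by \<open>N\<close>-th roots of unity replaces \<open>z - w\<close> by
  \<open>z ^ N - w ^ N\<close>, whose modulus is at least \<open>max (cmod z) (cmod w) ^ (N - 1) * \<bar>cmod z - cmod w\<bar>\<close>;
  the contribution of the last factor vanishes as \<open>N\<close> grows.\<close>

lemma set_integral_disk_ln_norm_diff_ge:
  "(LINT z:ball 0 1|lborel. ln (cmod (z - w))) \<ge>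
     pi * (if cmod w \<ge> 1 then ln (cmod w) else ((cmod w)\<^sup>2 - 1) / 2)"
proof -
  let ?D = "ball (0::complex) 1"
  define I where "I = (LINT z:?D|lborel. ln (cmod (z - w)))"
  define J where "J = (LINT z:?D|lborel. ln (max (cmod z) (cmod w)))"
  define K where "K = (LINT z:?D|lborel. ln \<bar>cmod z - cmod w\<bar>)"
  \<comment> \<open>This is \<open>N * I \<ge> (N - 1) * J + K\<close> divided by \<open>N\<close>.
    As \<open>J\<close> and \<open>K\<close> do not depend on \<open>N\<close>, the limit gives
    \<open>J \<le> I\<close>.\<close>
  have ge: "I \<ge> J + (K - J) / real N" if N: "N > 0" for N
  proof -
    let ?U = "{\<zeta>::complex. \<zeta> ^ N = 1}"
    have card: "card ?U = N"
      using N by (intro card_roots_unity_eq) auto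
    hence fin: "finite ?U" using N by (intro card_ge_0_finite) auto
    have norm1: "cmod \<zeta> = 1" if "\<zeta> \<in> ?U" for \<zeta>
      using that N norm_power[of \<zeta> N] power_eq_imp_eq_base[of "cmod \<zeta>" N 1] by simp
    have int: "set_integrable lborel ?D (\<lambda>z. ln (cmod (\<zeta> * z - w)))" if "\<zeta> \<in> ?U" for \<zeta>
    proof -
      have "\<zeta> \<noteq> 0" using norm1[OF that] by auto
      hence "\<zeta> * z - w = \<zeta> * (z - w / \<zeta>)" for z by (simp add: field_simps)
      hence "cmod (\<zeta> * z - w) = cmod (z - w / \<zeta>)" for z
        using norm1[OF that] by (simp add: norm_mult)
      thus ?thesis using set_integrable_disk_ln_norm_diff[of "w / \<zeta>"] by simp
    qed
    have rot: "(LINT z:?D|lborel. ln (cmod (\<zeta> * z - w))) = I" if "\<zeta> \<in> ?U" for \<zeta>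
      unfolding I_def by (rule set_integral_disk_rotate) (use norm1[OF that] in auto)
    have intJ: "set_integrable lborel ?D (\<lambda>z. real (N - 1) * ln (max (cmod z) (cmod w)))"
      by (cases "N = 1", simp add: set_integrable_def, intro set_integrable_mult_right set_integrable_disk_ln_max)
         (use N in auto)
    have "real (N - 1) * J + K =
        (LINT z:?D|lborel. real (N - 1) * ln (max (cmod z) (cmod w)) + ln \<bar>cmod z - cmod w\<bar>)"
      unfolding J_def K_def
      by (subst set_integral_add(2)[OF intJ set_integrable_disk_ln_dist]) auto
    also have "\<dots> \<le> (LINT z:?D|lborel. (\<Sum>\<zeta>\<in>?U. ln (cmod (\<zeta> * z - w))))"
    proof (rule set_integral_mono_AE)
      show "set_integrable lborel ?D
          (\<lambda>z. real (N - 1) * ln (max (cmod z) (cmod w)) + ln \<bar>cmod z - cmod w\<bar>)"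
        by (rule set_integral_add(1)[OF intJ set_integrable_disk_ln_dist]) auto
      show "set_integrable lborel ?D (\<lambda>z. \<Sum>\<zeta>\<in>?U. ln (cmod (\<zeta> * z - w)))"
        using int unfolding set_integrable_def scaleR_sum_right
        by (intro Bochner_Integration.integrable_sum) auto
      \<comment> \<open>Off the null set \<open>cmod z = cmod w\<close> all factors are nonzero, so
        the logarithm of the product splits.\<close>
      show "AE z\<in>?D in lborel. real (N - 1) * ln (max (cmod z) (cmod w)) + ln \<bar>cmod z - cmod w\<bar>
          \<le> (\<Sum>\<zeta>\<in>?U. ln (cmod (\<zeta> * z - w)))"
        using AE_norm_neq[of "cmod w"]
      proof eventually_elim
        case (elim z)
        have nz: "\<zeta> * z - w \<noteq> 0" if "\<zeta> \<in> ?U" for \<zeta>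
          using norm1[OF that] elim by (metis mult_1 norm_mult right_minus_eq)
        have "0 < max (cmod z) (cmod w)"
          using elim by (metis less_max_iff_disj zero_less_norm_iff norm_zero)
        hence pos: "max (cmod z) (cmod w) ^ (N - 1) > 0" "\<bar>cmod z - cmod w\<bar> > 0"
          using elim by auto
        have "real (N - 1) * ln (max (cmod z) (cmod w)) + ln \<bar>cmod z - cmod w\<bar> =
            ln (max (cmod z) (cmod w) ^ (N - 1) * \<bar>cmod z - cmod w\<bar>)"
          using pos \<open>0 < max (cmod z) (cmod w)\<close> by (simp add: ln_mult ln_realpow)
        also have "\<dots> \<le> ln (cmod (w ^ N - z ^ N))"
        proof (subst ln_le_cancel_iff)
          show pos': "0 < max (cmod z) (cmod w) ^ (N - 1) * \<bar>cmod z - cmod w\<bar>"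
            using pos by simp
          show "max (cmod z) (cmod w) ^ (N - 1) * \<bar>cmod z - cmod w\<bar> \<le> cmod (w ^ N - z ^ N)"
            by (rule norm_diff_powers_ge[OF N])
          thus "0 < cmod (w ^ N - z ^ N)" using pos' by linarith
        qed
        also have "w ^ N - z ^ N = (\<Prod>\<zeta>\<in>?U. w - \<zeta> * z)"
          using prod_unity_roots[OF N] by simp
        also have "cmod \<dots> = (\<Prod>\<zeta>\<in>?U. cmod (\<zeta> * z - w))"
          by (simp add: prod_norm norm_minus_commute)
        also have "ln \<dots> = (\<Sum>\<zeta>\<in>?U. ln (cmod (\<zeta> * z - w)))"
          using nz fin by (intro ln_prod) auto
        finally show ?case by simp
      qed
    qed
    also have "\<dots> = (\<Sum>\<zeta>\<in>?U. (LINT z:?D|lborel. ln (cmod (\<zeta> * z - w))))"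
      using int unfolding set_integrable_def set_lebesgue_integral_def scaleR_sum_right
      by (intro Bochner_Integration.integral_sum) auto
    also have "\<dots> = real N * I" using rot card by simp
    finally have "real N * J - J + K \<le> real N * I"
      using N by (simp add: of_nat_diff algebra_simps)
    thus ?thesis using N by (simp add: field_simps)
  qed
  have "(\<lambda>N. J + (K - J) / real N) \<longlonglongrightarrow> J + 0"
    by (intro tendsto_add tendsto_const lim_const_over_n)
  moreover have "\<exists>N0. \<forall>N\<ge>N0. J + (K - J) / real N \<le> I"
    by (intro exI[of _ 1]) (use ge in auto)
  ultimately have "J \<le> I"
    using LIMSEQ_le_const2[of _ "J + 0" I] by simp
  thus ?thesis
    unfolding I_def J_def by (subst (asm) set_integral_disk_ln_max) auto
qed

section \<open>Integer polynomials with simple zeros\<close>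

lemma complex_Ints_norm_ge_1:
  assumes "x \<in> \<int>" "x \<noteq> (0::complex)"
  shows "cmod x \<ge> 1"
  using assms by (auto elim!: Ints_cases simp: norm_of_int)

locale simple_int_poly =
  fixes P :: "int poly"
  assumes degree_pos: "degree P > 0"
    and rsquarefree: "rsquarefree (map_poly of_int P :: complex poly)"
begin

abbreviation p :: "complex poly" where "p \<equiv> map_poly of_int P"
abbreviation n :: nat where "n \<equiv> degree P"

definition Z :: "complex set" where "Z = {z. poly p z = 0}"
definition a :: real where "a = \<bar>of_int (lead_coeff P)\<bar>"

lemma P_nz: "P \<noteq> 0" using degree_pos by auto

lemma degree_p: "degree p = n" by (simp add: degree_map_poly)

lemma p_nz: "p \<noteq> 0" using degree_p degree_pos by auto

lemma finite_Z: "finite Z" unfolding Z_def by (rule poly_roots_finite[OF p_nz])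

lemma decomp: "p = Polynomial.smult (of_int (lead_coeff P)) (\<Prod>z\<in>Z. [:-z, 1:])"
proof -
  have "lead_coeff p = of_int (lead_coeff P)"
    unfolding degree_p by (simp add: coeff_map_poly)
  thus ?thesis
    using complex_poly_decompose_rsquarefree[OF rsquarefree] by (simp add: Z_def)
qed

lemma card_Z: "card Z = n"
proof -
  have "n = degree (Polynomial.smult (of_int (lead_coeff P)) (\<Prod>z\<in>Z. [:-z, 1:]) :: complex poly)"
    using decomp degree_p by simp
  also have "\<dots> = degree (\<Prod>z\<in>Z. [:-z, 1:])"
    using P_nz by simp
  also have "\<dots> = card Z"
    by (subst degree_prod_sum_eq) auto
  finally show ?thesis ..
qed

lemma a_ge_1: "a \<ge> 1"
proof -
  have "\<bar>lead_coeff P\<bar> \<ge> 1" using leading_coeff_0_iff[of P] P_nz by linarith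
  thus ?thesis unfolding a_def by (metis of_int_1_le_iff of_int_abs)
qed

lemma cmod_poly_p: "cmod (poly p x) = a * (\<Prod>z\<in>Z. cmod (x - z))"
proof -
  have "poly p x = of_int (lead_coeff P) * (\<Prod>z\<in>Z. x - z)"
    by (subst decomp) (simp add: poly_prod)
  thus ?thesis by (simp add: norm_mult a_def norm_of_int flip: prod_norm)
qed

lemma poly_pderiv_p:
  assumes "z \<in> Z"
  shows "poly (pderiv p) z = of_int (lead_coeff P) * (\<Prod>w\<in>Z - {z}. z - w)"
proof -
  have "p = [:-z, 1:] * Polynomial.smult (of_int (lead_coeff P)) (\<Prod>w\<in>Z - {z}. [:-w, 1:])"
    by (subst decomp, subst prod.remove[OF finite_Z assms]) simp
  also have "poly (pderiv \<dots>) z = of_int (lead_coeff P) * (\<Prod>w\<in>Z - {z}. z - w)"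
    unfolding pderiv_mult by (simp add: poly_prod pderiv_pCons)
  finally show ?thesis .
qed

lemma map_poly_pderiv: "map_poly of_int (pderiv P) = pderiv p"
  by (rule poly_eqI) (simp add: coeff_pderiv coeff_map_poly)

text \<open>The integer is the resultant of \<open>P\<close> and its derivative, up to sign the
  leading coefficient times the discriminant. The exponent is \<open>n - 1\<close> from the
  resultant plus \<open>n\<close> from the factor \<open>a\<close> in each derivative value.\<close>

lemma discriminant_ge_1: "1 \<le> a ^ (2 * n - 1) * (\<Prod>z\<in>Z. \<Prod>w\<in>Z - {z}. cmod (z - w))"
proof -
  let ?c = "of_int (lead_coeff P) :: complex"
  define x where "x = ?c ^ (n - 1) * (\<Prod>z\<in>Z. poly (pderiv p) z)"
  have "x \<in> \<int>"
    using resultant_in_Ints[of P "pderiv P" "n - 1"] card_Z P_nz degree_pderiv[of P]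
    unfolding x_def map_poly_pderiv Z_def by simp
  moreover have "x \<noteq> 0"
    using P_nz finite_Z by (auto simp: x_def poly_pderiv_p)
  ultimately have "1 \<le> cmod x" by (rule complex_Ints_norm_ge_1)
  also have "cmod x = a ^ (n - 1) * (\<Prod>z\<in>Z. a * (\<Prod>w\<in>Z - {z}. cmod (z - w)))"
    by (simp add: x_def norm_mult norm_power a_def norm_of_int poly_pderiv_p flip: prod_norm)
  also have "\<dots> = a ^ (n - 1 + n) * (\<Prod>z\<in>Z. \<Prod>w\<in>Z - {z}. cmod (z - w))"
    by (simp add: prod.distrib card_Z power_add)
  also have "n - 1 + n = 2 * n - 1" using degree_pos by simp
  finally show ?thesis .
qed

text \<open>The right-hand side is the modulus of the lowest nonzero coefficient: the constant one,
  or the linear one if 0 is a zero, which is then simple.\<close>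

lemma prod_nonzero_roots_ge_1: "1 \<le> a * (\<Prod>w\<in>Z - {0}. cmod w)"
proof (cases "0 \<in> Z")
  case True
  have "poly (pderiv p) 0 = of_int (poly (pderiv P) 0)"
    by (simp add: poly_0_coeff_0 coeff_pderiv coeff_map_poly)
  hence "poly (pderiv p) 0 \<in> \<int>" by simp
  moreover have "poly (pderiv p) 0 \<noteq> 0"
    using P_nz finite_Z by (simp add: poly_pderiv_p[OF True])
  ultimately have "1 \<le> cmod (poly (pderiv p) 0)" by (rule complex_Ints_norm_ge_1)
  also have "\<dots> = a * (\<Prod>w\<in>Z - {0}. cmod w)"
    by (simp add: poly_pderiv_p[OF True] norm_mult a_def norm_of_int flip: prod_norm)
  finally show ?thesis .
next
  case False
  have "poly p 0 = of_int (poly P 0)"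
    by (simp add: poly_0_coeff_0 coeff_map_poly)
  hence "poly p 0 \<in> \<int>" by simp
  moreover have "poly p 0 \<noteq> 0" using False by (simp add: Z_def)
  ultimately have "1 \<le> cmod (poly p 0)" by (rule complex_Ints_norm_ge_1)
  also have "\<dots> = a * (\<Prod>w\<in>Z - {0}. cmod w)"
    using False by (simp add: cmod_poly_p)
  finally show ?thesis .
qed

text \<open>The logarithm of the classical Mahler measure, by Jensen's formula.\<close>

definition L :: real where "L = ln a + (\<Sum>z\<in>Z. ln (max 1 (cmod z)))"

lemma ln_a_nonneg: "ln a \<ge> 0" using a_ge_1 by simp

text \<open>The zeros form a null set, so the logarithm of the modulus integrates as a sum over the
  zeros, to each of which \<open>set_integral_disk_ln_norm_diff_ge\<close> applies.\<close>

lemma ln_area_mahler_ge: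
  "ln (area_mahler p) \<ge> L - (\<Sum>z\<in>Z. (1 - (min 1 (cmod z))\<^sup>2) / 2)"
proof -
  let ?D = "ball (0::complex) 1"
  have "AE z in lborel. z \<notin> Z"
    by (rule AE_not_in) (use finite_Z in \<open>auto intro: finite_imp_null_set_lborel\<close>)
  hence *: "AE z\<in>?D in lborel. ln (cmod (poly p z)) = ln a + (\<Sum>w\<in>Z. ln (cmod (z - w)))"
  proof eventually_elim
    case (elim z)
    hence "(\<Prod>w\<in>Z. cmod (z - w)) > 0" by (intro prod_pos) auto
    thus ?case
      using elim a_ge_1 ln_prod[OF finite_Z, of "\<lambda>w. cmod (z - w)"]
      by (auto simp: cmod_poly_p ln_mult)
  qed
  have int: "set_integrable lborel ?D (\<lambda>z. \<Sum>w\<in>Z. ln (cmod (z - w)))"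
    using set_integrable_disk_ln_norm_diff unfolding set_integrable_def scaleR_sum_right
    by (intro Bochner_Integration.integrable_sum) auto
  have const: "set_integrable lborel ?D (\<lambda>z. ln a)"
    by (auto simp: set_integrable_def emeasure_ball)
  \<comment> \<open>With \<open>max\<close> and \<open>min\<close> the two cases of the lower bound
    become one formula: for each \<open>w\<close> at least one of the two terms vanishes.\<close>
  have "pi * (ln a + (\<Sum>w\<in>Z. ln (max 1 (cmod w)) - (1 - (min 1 (cmod w))\<^sup>2) / 2)) =
      pi * ln a + (\<Sum>w\<in>Z. pi * (if cmod w \<ge> 1 then ln (cmod w) else ((cmod w)\<^sup>2 - 1) / 2))"
    unfolding distrib_left sum_distrib_left
    by (intro arg_cong2[of _ _ _ _ "(+)"] sum.cong refl arg_cong2[of _ _ _ _ "(*)"])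
       (auto simp: max_def min_def field_simps)
  also have "\<dots> \<le> pi * ln a + (\<Sum>w\<in>Z. (LINT z:?D|lborel. ln (cmod (z - w))))"
    by (intro add_left_mono sum_mono set_integral_disk_ln_norm_diff_ge)
  also have "\<dots> = (LINT z:?D|lborel. ln a) + (LINT z:?D|lborel. (\<Sum>w\<in>Z. ln (cmod (z - w))))"
  proof (intro arg_cong2[of _ _ _ _ "(+)"])
    show "pi * ln a = (LINT z:?D|lborel. ln a)"
      by (simp add: set_lebesgue_integral_def content_ball unit_ball_vol_2)
    show "(\<Sum>w\<in>Z. (LINT z:?D|lborel. ln (cmod (z - w)))) =
        (LINT z:?D|lborel. (\<Sum>w\<in>Z. ln (cmod (z - w))))"
      using set_integrable_disk_ln_norm_diff
      unfolding set_integrable_def set_lebesgue_integral_def scaleR_sum_right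
      by (intro Bochner_Integration.integral_sum[symmetric]) auto
  qed
  also have "\<dots> = (LINT z:?D|lborel. ln a + (\<Sum>w\<in>Z. ln (cmod (z - w))))"
    by (rule set_integral_add(2)[OF const int, symmetric])
  also have "\<dots> = (LINT z:?D|lborel. ln (cmod (poly p z)))"
  proof (rule set_lebesgue_integral_cong_AE[symmetric])
    show "AE z\<in>?D in lborel. ln (cmod (poly p z)) = ln a + (\<Sum>w\<in>Z. ln (cmod (z - w)))"
      by (rule *)
    show "(\<lambda>z. ln (cmod (poly p z))) \<in> borel_measurable lborel"
      by (intro borel_measurable_ln borel_measurable_norm)
         (auto intro!: borel_measurable_continuous_onI continuous_intros)
  qed auto
  also have "\<dots> = pi * ln (area_mahler p)" by (simp add: area_mahler_def)
  finally have "ln a + (\<Sum>w\<in>Z. ln (max 1 (cmod w)) - (1 - (min 1 (cmod w))\<^sup>2) / 2) \<le> ln (area_mahler p)"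
    by simp
  thus ?thesis by (simp add: L_def sum_subtractf)
qed

end

text \<open>Near \<open>h = 1\<close> the functions \<open>- ln h\<close> and
  \<open>(1 - h\<^sup>2) / 2\<close> agree to first order and differ by
  \<open>(1 - h)\<^sup>2\<close> to second order. The surplus over that square has derivative
  \<open>- (1 - h)\<^sup>2 / h\<close> and vanishes at 1.\<close>

lemma square_le_minus_ln:
  fixes h :: real
  assumes "0 < h" "h \<le> 1"
  shows "(1 - h)\<^sup>2 \<le> - ln h - (1 - h\<^sup>2) / 2"
proof -
  let ?f = "\<lambda>h::real. - ln h - (1 - h\<^sup>2) / 2 - (1 - h)\<^sup>2"
  have "?f 1 \<le> ?f h"
  proof (rule DERIV_nonpos_imp_nonincreasing[OF assms(2)])
    fix x assume x: "h \<le> x" "x \<le> 1"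
    have "(?f has_real_derivative (- (1 / x) + x + 2 * (1 - x))) (at x)"
      using x assms by (auto intro!: derivative_eq_intros)
    moreover have "- (1 / x) + x + 2 * (1 - x) = - ((1 - x)\<^sup>2 / x)"
      using x assms by (simp add: field_simps power2_eq_square)
    ultimately show "\<exists>y. (?f has_real_derivative y) (at x) \<and> y \<le> 0"
      using x assms by (intro exI[of _ "- ((1 - x)\<^sup>2 / x)"]) auto
  qed
  thus ?thesis by simp
qed

text \<open>Only zeros inside the disk have a positive gap; those outside are measured by the terms
  \<open>ln (max 1 (cmod z))\<close> of \<open>L\<close>.\<close>

definition gap :: "complex \<Rightarrow> real" where "gap z = 1 - min 1 (cmod z)"

lemma gap_bounds: "0 \<le> gap z" "gap z \<le> 1" by (auto simp: gap_def)

context simple_int_poly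
begin

text \<open>The integer product bounds the sum of \<open>- ln h\<close> by \<open>L\<close>, and
  \<open>ln_area_mahler_ge\<close> bounds \<open>L\<close> by the area term plus the sum of
  \<open>(1 - h\<^sup>2) / 2\<close>. Subtracting leaves exactly the surplus of
  \<open>square_le_minus_ln\<close>, with no loss growing with the degree.\<close>

lemma sum_gap_squared_le: "(\<Sum>z\<in>Z. (gap z)\<^sup>2) \<le> ln (area_mahler p) + 3 / 2"
proof -
  let ?h = "\<lambda>z. min 1 (cmod z)"
  have pos: "(\<Prod>w\<in>Z - {0}. cmod w) > 0" by (intro prod_pos) auto
  have ln_split: "ln (cmod w) = ln (max 1 (cmod w)) + ln (?h w)" for w
    by (cases "cmod w \<le> 1") (auto simp: max_def min_def)
  have sum_split: "(\<Sum>z\<in>Z. f z) = (\<Sum>z\<in>Z - {0}. f z) + (if 0 \<in> Z then f 0 else 0)"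
    for f :: "complex \<Rightarrow> real"
    using finite_Z by (auto simp: sum.remove)
  have "0 \<le> ln (a * (\<Prod>w\<in>Z - {0}. cmod w))"
    using prod_nonzero_roots_ge_1 by simp
  also have "\<dots> = ln a + (\<Sum>w\<in>Z - {0}. ln (cmod w))"
    using a_ge_1 pos finite_Z ln_prod[of "Z - {0}" cmod] by (auto simp: ln_mult)
  also have "\<dots> = L + (\<Sum>w\<in>Z - {0}. ln (?h w))"
    by (simp add: L_def ln_split sum.distrib sum_split[of "\<lambda>z. ln (max 1 (cmod z))"])
  finally have *: "0 \<le> L + (\<Sum>w\<in>Z - {0}. ln (?h w))" .
  have "(\<Sum>z\<in>Z - {0}. (gap z)\<^sup>2) \<le> (\<Sum>z\<in>Z - {0}. - ln (?h z) - (1 - (?h z)\<^sup>2) / 2)"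
    unfolding gap_def by (intro sum_mono square_le_minus_ln) auto
  also have "\<dots> = - (\<Sum>z\<in>Z - {0}. ln (?h z)) - (\<Sum>z\<in>Z - {0}. (1 - (?h z)\<^sup>2) / 2)"
    by (simp add: sum_subtractf sum_negf)
  finally have 1: "(\<Sum>z\<in>Z - {0}. (gap z)\<^sup>2) \<le>
      - (\<Sum>z\<in>Z - {0}. ln (?h z)) - (\<Sum>z\<in>Z - {0}. (1 - (?h z)\<^sup>2) / 2)" .
  \<comment> \<open>A zero at the origin is left out of the logarithms. It adds 1 to the squares
    here and 1/2 to the area term below, hence the constant 3/2.\<close>
  have 2: "(\<Sum>z\<in>Z. (gap z)\<^sup>2) \<le> (\<Sum>z\<in>Z - {0}. (gap z)\<^sup>2) + 1"
    by (subst sum_split) (simp add: gap_def)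
  have 3: "(\<Sum>z\<in>Z. (1 - (?h z)\<^sup>2) / 2) \<le> (\<Sum>z\<in>Z - {0}. (1 - (?h z)\<^sup>2) / 2) + 1 / 2"
    by (subst sum_split) simp
  show ?thesis using * 1 2 3 ln_area_mahler_ge by linarith
qed

lemma L_le: "L \<le> ln (area_mahler p) + (\<Sum>z\<in>Z. gap z)"
proof -
  have "(\<Sum>z\<in>Z. (1 - (min 1 (cmod z))\<^sup>2) / 2) \<le> (\<Sum>z\<in>Z. gap z)"
  proof (rule sum_mono)
    fix z :: complex
    have "(1 - h\<^sup>2) / 2 \<le> 1 - h" for h :: real
      using zero_le_power2[of "1 - h"] by (simp add: power2_eq_square field_simps)
    thus "(1 - (min 1 (cmod z))\<^sup>2) / 2 \<le> gap z" by (simp add: gap_def)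
  qed
  thus ?thesis using ln_area_mahler_ge by linarith
qed

lemma L_nonneg: "L \<ge> 0"
  unfolding L_def by (intro add_nonneg_nonneg sum_nonneg ln_a_nonneg) auto

text \<open>Cauchy-Schwarz over the \<open>n\<close> zeros: if \<open>ln (area_mahler p)\<close> is
  o(n), so is the sum of the gaps.\<close>

lemma sum_gap_le: "(\<Sum>z\<in>Z. gap z) \<le> sqrt (real n * (ln (area_mahler p) + 3 / 2))"
proof (rule real_le_rsqrt)
  have "(\<Sum>z\<in>Z. gap z)\<^sup>2 \<le> (\<Sum>z\<in>Z. (gap z)\<^sup>2) * real n"
    using sum_squared_le_sum_of_squares[of gap Z] by (simp add: card_Z)
  also have "\<dots> \<le> (ln (area_mahler p) + 3 / 2) * real n"
    by (intro mult_right_mono sum_gap_squared_le) auto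
  finally show "(\<Sum>z\<in>Z. gap z)\<^sup>2 \<le> real n * (ln (area_mahler p) + 3 / 2)" by (simp add: mult_ac)
qed

end

section \<open>The energy estimate\<close>

definition inner_reflection :: "complex \<Rightarrow> complex" where
  "inner_reflection z = (if cmod z \<le> 1 then z else 1 / cnj z)"

lemma cmod_inner_reflection_le_1: "cmod (inner_reflection z) \<le> 1"
  by (auto simp: inner_reflection_def norm_divide divide_simps)

text \<open>The hypothesis keeps the points from lying strictly on opposite sides of the circle, and
  its product is exactly the difference of the squared norms.\<close>

lemma norm_diff_le_norm_one_minus:
  fixes z w :: complex
  assumes "0 \<le> (1 - (cmod z)\<^sup>2) * (1 - (cmod w)\<^sup>2)"
  shows "cmod (z - w) \<le> cmod (1 - z * cnj w)"
proof (rule power2_le_imp_le)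
  have "(cmod (1 - z * cnj w))\<^sup>2 - (cmod (z - w))\<^sup>2 = (1 - (cmod z)\<^sup>2) * (1 - (cmod w)\<^sup>2)"
    unfolding cmod_power2 by (simp add: power2_eq_square algebra_simps)
  with assms show "(cmod (z - w))\<^sup>2 \<le> (cmod (1 - z * cnj w))\<^sup>2" by linarith
qed simp

text \<open>Reflecting an outer point costs its modulus, and over all pairs these factors amount to
  powers of the Mahler measure. For points on different sides this is an equality; otherwise
  \<open>norm_diff_le_norm_one_minus\<close> applies, after extracting \<open>cnj z * w\<close> if
  both lie outside.\<close>

lemma norm_diff_le_inner_reflection:
  "cmod (z - w) \<le> max 1 (cmod z) * max 1 (cmod w) *
     cmod (1 - inner_reflection z * cnj (inner_reflection w))"
proof -
  consider "cmod z \<le> 1" "cmod w \<le> 1" | "cmod z > 1" "cmod w > 1"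
    | "cmod z \<le> 1" "cmod w > 1" | "cmod z > 1" "cmod w \<le> 1" by linarith
  thus ?thesis
  proof cases
    case 1
    have "cmod (z - w) \<le> cmod (1 - z * cnj w)"
      by (rule norm_diff_le_norm_one_minus) (use 1 in \<open>auto intro!: mult_nonneg_nonneg simp: power_le_one\<close>)
    with 1 show ?thesis by (simp add: inner_reflection_def)
  next
    case 2
    hence nz: "z \<noteq> 0" "w \<noteq> 0" by auto
    have "cmod (z - w) \<le> cmod (1 - z * cnj w)"
      by (rule norm_diff_le_norm_one_minus)
         (use 2 in \<open>auto intro!: mult_nonpos_nonpos simp: one_le_power less_imp_le\<close>)
    also have "\<dots> = cmod (1 - w * cnj z)"
      by (subst complex_mod_cnj[symmetric]) (simp add: mult.commute)
    also have "\<dots> = cmod (cnj z * w * (1 - 1 / cnj z * (1 / w)))"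
      using nz by (simp add: right_diff_distrib norm_minus_commute mult.commute)
    also have "\<dots> = cmod z * cmod w * cmod (1 - 1 / cnj z * (1 / w))"
      by (simp add: norm_mult)
    finally show ?thesis using 2 by (simp add: inner_reflection_def)
  next
    case 3
    hence "z - w = - (w * (1 - z * (1 / w)))" by (auto simp: field_simps)
    hence "cmod (z - w) = cmod w * cmod (1 - z * (1 / w))"
      by (simp only: norm_minus_cancel norm_mult)
    with 3 show ?thesis by (simp add: inner_reflection_def)
  next
    case 4
    hence "cnj (z - w) = cnj z * (1 - 1 / cnj z * cnj w)" by (auto simp: field_simps)
    hence "cmod (cnj (z - w)) = cmod (cnj z) * cmod (1 - 1 / cnj z * cnj w)"
      by (simp only: norm_mult)
    with 4 show ?thesis by (simp add: inner_reflection_def del: complex_cnj_diff)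
  qed
qed

text \<open>The constant is attained at \<open>u = -1\<close> and tends to 1 with \<rho>, so that
  its logarithm is negligible per pair.\<close>

lemma norm_one_minus_le_damped:
  fixes u :: complex
  assumes "cmod u \<le> 1" "0 < \<rho>" "\<rho> < 1"
  shows "cmod (1 - u) \<le> 2 / (1 + \<rho>) * cmod (1 - of_real \<rho> * u)"
proof -
  have "(1 + \<rho>) * cmod (1 - u) \<le> 2 * cmod (1 - of_real \<rho> * u)"
  proof (rule power2_le_imp_le)
    define x s where "x = Re u" and "s = (cmod u)\<^sup>2"
    have s: "s \<le> 1" using assms(1) by (simp add: s_def power_le_one)
    have "\<bar>Re u\<bar> \<le> cmod u" by (rule abs_Re_le_cmod)
    hence x: "x \<ge> -1" using assms(1) unfolding x_def by linarith
    have 1: "(cmod (1 - u))\<^sup>2 = 1 - 2 * x + s"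
      unfolding s_def x_def cmod_power2 by (simp add: power2_eq_square algebra_simps)
    have 2: "(cmod (1 - of_real \<rho> * u))\<^sup>2 = 1 - 2 * \<rho> * x + \<rho>\<^sup>2 * s"
      unfolding s_def x_def cmod_power2 by (simp add: power2_eq_square algebra_simps)
    \<comment> \<open>The difference of the squares, arranged so that \<open>x \<ge> -1\<close> and
      \<open>s \<le> 1\<close> make every term nonnegative.\<close>
    have "4 * (1 - 2 * \<rho> * x + \<rho>\<^sup>2 * s) - (1 + \<rho>)\<^sup>2 * (1 - 2 * x + s) =
        (1 - \<rho>) * (2 * (1 - \<rho>) * (x + 1) + (1 + 3 * \<rho>) * (1 - s))"
      by (simp add: power2_eq_square algebra_simps)
    also have "\<dots> \<ge> 0"
    proof -
      have "0 \<le> x + 1" using x by simp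
      hence "0 \<le> 2 * (1 - \<rho>) * (x + 1)" "0 \<le> (1 + 3 * \<rho>) * (1 - s)"
        using assms s by simp_all
      thus ?thesis using assms by simp
    qed
    finally show "((1 + \<rho>) * cmod (1 - u))\<^sup>2 \<le> (2 * cmod (1 - of_real \<rho> * u))\<^sup>2"
      by (simp add: power_mult_distrib 1 2)
  qed simp
  thus ?thesis using assms by (simp add: field_simps)
qed

text \<open>Real part of the Taylor series of the principal logarithm; the term at
  \<open>m = 0\<close> vanishes because division by 0 yields 0.\<close>

lemma ln_norm_one_minus_sums:
  fixes v :: complex
  assumes "cmod v < 1"
  shows "(\<lambda>m. - Re (v ^ m) / real m) sums ln (cmod (1 - v))"
proof -
  have ne: "1 - v \<noteq> 0" using assms by auto
  have "(\<lambda>m. (-1) ^ Suc m / of_nat m * (- v) ^ m) sums Ln (1 + (- v))"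
    using assms by (intro Ln_series) simp
  hence "(\<lambda>m. Re ((-1) ^ Suc m / of_nat m * (- v) ^ m)) sums Re (Ln (1 + (- v)))"
    by (rule sums_Re)
  moreover have "Re ((-1) ^ Suc m / of_nat m * (- v) ^ m) = - Re (v ^ m) / real m" for m
  proof -
    have "(-1) ^ Suc m / of_nat m * (- v) ^ m = - (v ^ m) / of_nat m"
      by (subst power_minus[of v]) (simp add: power_mult_distrib[symmetric] flip: mult.assoc)
    thus ?thesis by (simp only: Re_divide_of_nat) simp
  qed
  ultimately have "(\<lambda>m. - Re (v ^ m) / real m) sums Re (Ln (1 + (- v)))" by (simp only:)
  thus ?thesis using ne by (simp add: Re_Ln)
qed

text \<open>In the logarithmic series the sum of \<open>(u i * cnj (u j)) ^ m\<close> over all pairs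
  factors into the squared modulus of the \<open>m\<close>-th power sum. All terms are then
  nonpositive, so any single one is an upper bound. Damping makes the series converge on the
  diagonal too.\<close>

lemma sum_ln_norm_one_minus_le:
  fixes u :: "'a \<Rightarrow> complex"
  assumes "finite A" "\<And>i. i \<in> A \<Longrightarrow> cmod (u i) \<le> 1" "0 < \<rho>" "\<rho> < 1"
  shows "(\<Sum>i\<in>A. \<Sum>j\<in>A. ln (cmod (1 - of_real \<rho> * (u i * cnj (u j))))) \<le>
    - (\<rho> ^ k / real k * (cmod (\<Sum>i\<in>A. u i ^ k))\<^sup>2)"
proof -
  let ?v = "\<lambda>i j. of_real \<rho> * (u i * cnj (u j))"
  define f where "f m = \<rho> ^ m / real m * (cmod (\<Sum>i\<in>A. u i ^ m))\<^sup>2" for m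
  have lt: "cmod (?v i j) < 1" if "i \<in> A" "j \<in> A" for i j
  proof -
    have "cmod (u i) * cmod (u j) \<le> 1 * 1"
      using that assms by (intro mult_mono) auto
    hence "\<rho> * (cmod (u i) * cmod (u j)) \<le> \<rho> * 1"
      using assms by (intro mult_left_mono) auto
    moreover have "cmod (?v i j) = \<rho> * (cmod (u i) * cmod (u j))"
      using assms by (simp add: norm_mult)
    ultimately show ?thesis using assms by linarith
  qed
  have "(\<lambda>m. \<Sum>i\<in>A. \<Sum>j\<in>A. - Re (?v i j ^ m) / real m) sums
      (\<Sum>i\<in>A. \<Sum>j\<in>A. ln (cmod (1 - ?v i j)))"
    by (intro sums_sum ln_norm_one_minus_sums lt)
  moreover have "(\<Sum>i\<in>A. \<Sum>j\<in>A. - Re (?v i j ^ m) / real m) = - f m" for m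
  proof -
    have "(\<Sum>i\<in>A. \<Sum>j\<in>A. ?v i j ^ m) = of_real (\<rho> ^ m) * ((\<Sum>i\<in>A. u i ^ m) * cnj (\<Sum>i\<in>A. u i ^ m))"
    proof -
      have "(\<Sum>i\<in>A. u i ^ m) * cnj (\<Sum>i\<in>A. u i ^ m) = (\<Sum>i\<in>A. \<Sum>j\<in>A. u i ^ m * cnj (u j ^ m))"
        by (simp only: cnj_sum sum_product)
      thus ?thesis
        by (simp only: sum_distrib_left power_mult_distrib complex_cnj_power of_real_power)
    qed
    also have "\<dots> = of_real (\<rho> ^ m * (cmod (\<Sum>i\<in>A. u i ^ m))\<^sup>2)"
      by (simp only: complex_norm_square of_real_mult)
    finally have eq: "(\<Sum>i\<in>A. \<Sum>j\<in>A. ?v i j ^ m) = of_real (\<rho> ^ m * (cmod (\<Sum>i\<in>A. u i ^ m))\<^sup>2)" .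
    have "(\<Sum>i\<in>A. \<Sum>j\<in>A. Re (?v i j ^ m)) = \<rho> ^ m * (cmod (\<Sum>i\<in>A. u i ^ m))\<^sup>2"
      using arg_cong[OF eq, of Re] by (simp only: Re_sum Re_complex_of_real)
    thus ?thesis
      by (simp add: f_def sum_negf flip: sum_divide_distrib)
  qed
  ultimately have "(\<lambda>m. - f m) sums (\<Sum>i\<in>A. \<Sum>j\<in>A. ln (cmod (1 - ?v i j)))" by simp
  from sums_minus[OF this] have s: "f sums - (\<Sum>i\<in>A. \<Sum>j\<in>A. ln (cmod (1 - ?v i j)))" by simp
  have "f k \<le> suminf f"
    using sum_le_suminf[of f "{k}"] s assms by (auto simp: sums_iff f_def)
  with s show ?thesis by (simp add: sums_iff f_def)
qed

context simple_int_poly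
begin

text \<open>The energy of all ordered pairs is bounded below by \<open>discriminant_ge_1\<close> and
  above by \<open>sum_ln_norm_one_minus_le\<close>. The three terms on the right are the costs of
  reflection and leading coefficient, of damping, and of the diagonal.\<close>

lemma energy_bound:
  assumes \<rho>: "0 < \<rho>" "\<rho> < 1"
  shows "\<rho> ^ k / real k * (cmod (\<Sum>z\<in>Z. inner_reflection z ^ k))\<^sup>2 \<le>
    2 * real n * L + (real n)\<^sup>2 * ln (2 / (1 + \<rho>)) - real n * ln (1 - \<rho>)"
proof -
  let ?r = inner_reflection
  define m where "m z = ln (max 1 (cmod z))" for z :: complex
  define c where "c = ln (2 / (1 + \<rho>))"
  define g where "g z w = ln (cmod (1 - of_real \<rho> * (?r z * cnj (?r w))))" for z w
  have m_nonneg: "m z \<ge> 0" for z by (simp add: m_def)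
  have c_nonneg: "c \<ge> 0" using \<rho> by (simp add: c_def)
  have u_le: "cmod (?r z * cnj (?r w)) \<le> 1" for z w
    using mult_mono[OF cmod_inner_reflection_le_1[of z] cmod_inner_reflection_le_1[of w]]
    by (simp add: norm_mult)
  have pair: "ln (cmod (z - w)) \<le> m z + m w + c + g z w" if "z \<noteq> w" for z w
  proof -
    let ?d = "cmod (1 - of_real \<rho> * (?r z * cnj (?r w)))"
    have "cmod (z - w) \<le> max 1 (cmod z) * max 1 (cmod w) * cmod (1 - ?r z * cnj (?r w))"
      by (rule norm_diff_le_inner_reflection)
    also have "\<dots> \<le> max 1 (cmod z) * max 1 (cmod w) * (2 / (1 + \<rho>) * ?d)"
      by (intro mult_left_mono norm_one_minus_le_damped u_le \<rho>) auto
    finally have le: "cmod (z - w) \<le> max 1 (cmod z) * max 1 (cmod w) * (2 / (1 + \<rho>) * ?d)" .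
    have "?d \<noteq> 0"
    proof
      assume "?d = 0"
      hence "cmod (z - w) \<le> 0" using le by simp
      thus False using that by simp
    qed
    hence d: "?d > 0" by simp
    have "ln (cmod (z - w)) \<le> ln (max 1 (cmod z) * max 1 (cmod w) * (2 / (1 + \<rho>) * ?d))"
      using le that by (intro ln_mono) auto
    also have "\<dots> = ln (max 1 (cmod z)) + ln (max 1 (cmod w)) + (ln (2 / (1 + \<rho>)) + ln ?d)"
    proof -
      have "max 1 (cmod z) > 0" "max 1 (cmod w) > 0" "2 / (1 + \<rho>) > 0" using \<rho> by auto
      thus ?thesis using d by (simp only: ln_mult_pos mult_pos_pos)
    qed
    finally show ?thesis by (simp add: m_def c_def g_def)
  qed
  \<comment> \<open>The discriminant has no diagonal terms. Damping keeps each of them at least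
    \<open>ln (1 - \<rho>)\<close>, so the double sum can be completed at that price.\<close>
  have diag: "ln (1 - \<rho>) \<le> m z + m z + c + g z z" for z
  proof -
    have "1 - \<rho> \<le> 1 - \<rho> * cmod (?r z * cnj (?r z))"
      using u_le[of z z] \<rho> by (simp add: mult_left_le)
    also have "\<dots> \<le> cmod (1 - of_real \<rho> * (?r z * cnj (?r z)))"
      using norm_triangle_ineq2[of 1 "of_real \<rho> * (?r z * cnj (?r z))"] \<rho>
      by (simp add: norm_mult)
    finally have "ln (1 - \<rho>) \<le> g z z"
      unfolding g_def using \<rho> by (intro ln_mono) auto
    thus ?thesis using m_nonneg[of z] c_nonneg by linarith
  qed
  have pos: "(\<Prod>w\<in>Z - {z}. cmod (z - w)) > 0" for z by (intro prod_pos) auto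
  have ln_inner: "ln (\<Prod>w\<in>Z - {z}. cmod (z - w)) = (\<Sum>w\<in>Z - {z}. ln (cmod (z - w)))" for z
    using finite_Z by (intro ln_prod) auto
  have "0 \<le> ln (a ^ (2 * n - 1) * (\<Prod>z\<in>Z. \<Prod>w\<in>Z - {z}. cmod (z - w)))"
    using discriminant_ge_1 by simp
  also have "\<dots> = ln (a ^ (2 * n - 1)) + ln (\<Prod>z\<in>Z. \<Prod>w\<in>Z - {z}. cmod (z - w))"
    using a_ge_1 pos by (intro ln_mult_pos prod_pos) auto
  also have "ln (\<Prod>z\<in>Z. \<Prod>w\<in>Z - {z}. cmod (z - w)) =
      (\<Sum>z\<in>Z. ln (\<Prod>w\<in>Z - {z}. cmod (z - w)))"
    by (intro ln_prod finite_Z) (metis pos less_irrefl)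
  also have "ln (a ^ (2 * n - 1)) = real (2 * n - 1) * ln a"
    using a_ge_1 by (simp add: ln_realpow)
  \<comment> \<open>Rounding the exponent up lets \<open>ln a\<close> join the terms
    \<open>m z\<close>, each of which occurs \<open>2 * n\<close> times below, to form
    \<open>2 * n * L\<close>.\<close>
  also have "\<dots> \<le> 2 * real n * ln a"
    by (intro mult_right_mono ln_a_nonneg) auto
  finally have "0 \<le> 2 * real n * ln a + (\<Sum>z\<in>Z. \<Sum>w\<in>Z - {z}. ln (cmod (z - w)))"
    unfolding ln_inner by simp
  also have "(\<Sum>z\<in>Z. \<Sum>w\<in>Z - {z}. ln (cmod (z - w))) \<le>
      (\<Sum>z\<in>Z. (\<Sum>w\<in>Z. m z + m w + c + g z w) - ln (1 - \<rho>))"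
  proof (rule sum_mono)
    fix z assume z: "z \<in> Z"
    have "(\<Sum>w\<in>Z - {z}. ln (cmod (z - w))) \<le> (\<Sum>w\<in>Z - {z}. m z + m w + c + g z w)"
      by (intro sum_mono pair) auto
    also have "\<dots> \<le> (\<Sum>w\<in>Z. m z + m w + c + g z w) - ln (1 - \<rho>)"
      using diag[of z] by (simp add: sum.remove[OF finite_Z z])
    finally show "(\<Sum>w\<in>Z - {z}. ln (cmod (z - w))) \<le>
        (\<Sum>w\<in>Z. m z + m w + c + g z w) - ln (1 - \<rho>)" .
  qed
  also have "(\<Sum>z\<in>Z. (\<Sum>w\<in>Z. m z + m w + c + g z w) - ln (1 - \<rho>)) =
      2 * real n * (\<Sum>z\<in>Z. m z) + (real n)\<^sup>2 * c + (\<Sum>z\<in>Z. \<Sum>w\<in>Z. g z w) - real n * ln (1 - \<rho>)"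
    by (simp add: sum.distrib sum_subtractf card_Z power2_eq_square flip: sum_distrib_left)
  also have "(\<Sum>z\<in>Z. \<Sum>w\<in>Z. g z w) \<le>
      - (\<rho> ^ k / real k * (cmod (\<Sum>z\<in>Z. ?r z ^ k))\<^sup>2)"
    unfolding g_def
    by (rule sum_ln_norm_one_minus_le[OF finite_Z cmod_inner_reflection_le_1 \<rho>])
  finally show ?thesis by (simp add: L_def m_def c_def algebra_simps)
qed

end

section \<open>Weyl's criterion on the unit circle\<close>

definition circle_mean :: "(complex \<Rightarrow> complex) \<Rightarrow> complex" where
  "circle_mean f = (LINT t:{0..<2 * pi}|lborel. f (cis t)) / of_real (2 * pi)"

lemma cis_borel_measurable [measurable]: "cis \<in> borel_measurable borel"
  by (intro borel_measurable_continuous_onI continuous_intros)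

lemma integral_unit_circle_measure:
  assumes "continuous_on UNIV f"
  shows "(LINT z|unit_circle_measure. f z) = circle_mean f"
proof -
  have f [measurable]: "f \<in> borel_measurable borel"
    using assms by (rule borel_measurable_continuous_onI)
  have "inverse (2 * ennreal pi) = ennreal (1 / (2 * pi))"
    by (subst ennreal_numeral[symmetric], subst ennreal_mult[symmetric])
       (auto simp: inverse_ennreal inverse_eq_divide)
  hence U: "uniform_measure lborel {0..<2 * pi} =
      density lborel (\<lambda>t. ennreal (indicator {0..<2 * pi} t / (2 * pi)))"
    unfolding uniform_measure_def
    by (intro density_cong) (auto simp: divide_ennreal_def indicator_def ennreal_mult)
  have "(LINT z|unit_circle_measure. f z) =
      (LINT t|lborel. (indicator {0..<2 * pi} t / (2 * pi)) *\<^sub>R f (cis t))"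
    unfolding unit_circle_measure_def U
    by (subst integral_distr, simp, simp, subst integral_density) auto
  also have "\<dots> = (LINT t|lborel. (indicator {0..<2 * pi} t *\<^sub>R f (cis t)) / of_real (2 * pi))"
    by (intro Bochner_Integration.integral_cong) (auto simp: scaleR_conv_of_real)
  also have "\<dots> = circle_mean f"
    unfolding circle_mean_def set_lebesgue_integral_def by (rule integral_divide_zero)
  finally show ?thesis .
qed

lemma set_integrable_circle:
  fixes f :: "complex \<Rightarrow> complex"
  assumes "continuous_on UNIV f"
  shows "set_integrable lborel {0..<2 * pi} (\<lambda>t. f (cis t))"
proof -
  have "set_integrable lborel {0..2 * pi} (\<lambda>t. f (cis t))"
    unfolding set_integrable_def
    by (rule borel_integrable_compact)
       (auto intro!: continuous_on_compose2[OF assms] continuous_intros)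
  thus ?thesis by (rule set_integrable_subset) auto
qed

lemma circle_mean_add:
  assumes "continuous_on UNIV f" "continuous_on UNIV g"
  shows "circle_mean (\<lambda>z. f z + g z) = circle_mean f + circle_mean g"
  unfolding circle_mean_def
  by (subst set_integral_add(2)) (auto intro!: set_integrable_circle assms simp: add_divide_distrib)

lemma circle_mean_cong:
  assumes "\<And>z. cmod z = 1 \<Longrightarrow> f z = g z"
  shows "circle_mean f = circle_mean g"
  unfolding circle_mean_def by (simp add: assms)

lemma circle_mean_cmult: "circle_mean (\<lambda>z. c * f z) = c * circle_mean f"
  unfolding circle_mean_def by simp

lemma circle_mean_const: "circle_mean (\<lambda>z. c) = c"
  unfolding circle_mean_def set_lebesgue_integral_def by (simp add: scaleR_conv_of_real)

lemma norm_circle_mean_diff_le: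
  assumes "continuous_on UNIV f" "continuous_on UNIV g"
    and le: "\<And>z. cmod z = 1 \<Longrightarrow> cmod (f z - g z) \<le> e"
  shows "cmod (circle_mean f - circle_mean g) \<le> e"
proof -
  have "cmod (LINT t:{0..<2 * pi}|lborel. f (cis t) - g (cis t)) \<le> (LINT t:{0..<2 * pi}|lborel. e)"
    unfolding set_lebesgue_integral_def
  proof (rule order_trans[OF integral_norm_bound], rule integral_mono)
    show "integrable lborel (\<lambda>t. cmod (indicat_real {0..<2 * pi} t *\<^sub>R (f (cis t) - g (cis t))))"
      using set_integral_diff(1)[OF set_integrable_circle[OF assms(1)] set_integrable_circle[OF assms(2)]]
      unfolding set_integrable_def by (rule integrable_norm)
    show "integrable lborel (\<lambda>t. indicat_real {0..<2 * pi} t *\<^sub>R e)" by simp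
    show "cmod (indicat_real {0..<2 * pi} t *\<^sub>R (f (cis t) - g (cis t))) \<le>
        indicat_real {0..<2 * pi} t *\<^sub>R e" for t
      using le[of "cis t"] by (simp add: indicator_def)
  qed
  also have "\<dots> = 2 * pi * e" by (simp add: set_lebesgue_integral_def)
  finally have "cmod (LINT t:{0..<2 * pi}|lborel. f (cis t) - g (cis t)) / (2 * pi) \<le> e"
    by (simp add: divide_simps mult_ac)
  moreover have "circle_mean f - circle_mean g =
      (LINT t:{0..<2 * pi}|lborel. f (cis t) - g (cis t)) / of_real (2 * pi)"
    unfolding circle_mean_def
    by (subst set_integral_diff(2)) (auto intro!: set_integrable_circle assms simp: diff_divide_distrib)
  ultimately show ?thesis by (simp add: norm_divide)
qed

lemma circle_mean_power:
  assumes "k > 0"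
  shows "circle_mean (\<lambda>z. z ^ k) = 0"
proof -
  let ?F = "\<lambda>t. cis (real k * t) / (\<i> * of_nat k)"
  have "((\<lambda>t. cis t ^ k) has_integral (?F (2 * pi) - ?F 0)) {0..2 * pi}"
  proof (rule fundamental_theorem_of_calculus)
    fix t :: real
    have "((\<lambda>z. exp (\<i> * (of_nat k * z)) / (\<i> * of_nat k)) has_field_derivative
        exp (\<i> * (of_nat k * of_real t))) (at (of_real t))"
      using assms by (auto intro!: derivative_eq_intros simp: complex_eq_iff)
    from has_vector_derivative_real_field[OF this]
    show "(?F has_vector_derivative cis t ^ k) (at t within {0..2 * pi})"
      unfolding Complex.DeMoivre by (simp add: cis_conv_exp)
  qed simp
  moreover have "cis (real k * (2 * pi)) = 1"
    using cis_multiple_2pi[of "real k"] by (simp add: mult.commute)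
  ultimately have int: "((\<lambda>t. cis t ^ k) has_integral 0) {0..2 * pi}" by simp
  have neg1: "negligible {t \<in> {0..2 * pi} - {0..<2 * pi}. cis t ^ k \<noteq> 0}"
    by (rule negligible_subset[of "{2 * pi}"]) auto
  have neg2: "negligible {t \<in> {0..<2 * pi} - {0..2 * pi}. cis t ^ k \<noteq> 0}"
    by (rule negligible_subset[of "{}"]) auto
  have "((\<lambda>t. cis t ^ k) has_integral 0) {0..<2 * pi}"
    by (rule has_integral_spike_set_eq[OF neg1 neg2, THEN iffD1, OF int])
  moreover have "(LINT t:{0..<2 * pi}|lborel. cis t ^ k) = integral {0..<2 * pi} (\<lambda>t. cis t ^ k)"
    by (rule set_borel_integral_eq_integral(2)[OF set_integrable_circle[of "\<lambda>z. z ^ k"]])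
       (auto intro!: continuous_intros)
  ultimately show ?thesis by (simp add: circle_mean_def integral_unique)
qed

lemma circle_mean_cnj: "circle_mean (\<lambda>z. cnj (f z)) = cnj (circle_mean f)"
proof -
  have "(LINT t:{0..<2 * pi}|lborel. cnj (f (cis t))) = cnj (LINT t:{0..<2 * pi}|lborel. f (cis t))"
    unfolding set_lebesgue_integral_def Bochner_Integration.integral_cnj[symmetric]
    by (simp only: complex_cnj_scaleR)
  thus ?thesis by (simp add: circle_mean_def)
qed

text \<open>The bridge between polynomials in real and imaginary part, as Stone-Weierstrass supplies
  them, and powers of \<open>z\<close>. With both \<open>z\<close> and \<open>cnj z\<close> the
  class is closed under products on the whole plane; \<open>z * cnj z = 1\<close> is invoked only
  later, on the circle.\<close>

inductive trig_poly :: "(complex \<Rightarrow> complex) \<Rightarrow> bool" where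
  monom: "trig_poly (\<lambda>z. c * z ^ i * cnj z ^ j)"
| add: "trig_poly f \<Longrightarrow> trig_poly g \<Longrightarrow> trig_poly (\<lambda>z. f z + g z)"

lemma trig_poly_const: "trig_poly (\<lambda>z. c)"
  using trig_poly.monom[of c 0 0] by simp

lemma trig_poly_mult:
  assumes "trig_poly f" "trig_poly g"
  shows "trig_poly (\<lambda>z. f z * g z)"
  using assms(1)
proof induction
  case (monom c i j)
  show ?case using assms(2)
  proof induction
    case (monom c' i' j')
    have "(\<lambda>z. c * z ^ i * cnj z ^ j * (c' * z ^ i' * cnj z ^ j')) =
        (\<lambda>z. (c * c') * z ^ (i + i') * cnj z ^ (j + j'))"
      by (simp add: power_add mult_ac)
    thus ?case by (simp only: trig_poly.monom)
  next
    case (add f g)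
    thus ?case by (simp add: distrib_left trig_poly.add)
  qed
next
  case (add f' g')
  thus ?case by (simp add: distrib_right trig_poly.add)
qed

lemma trig_poly_real_polynomial_function:
  assumes "real_polynomial_function r"
  shows "trig_poly (\<lambda>z. of_real (r z))"
  using assms
proof induction
  case (linear h)
  then interpret bounded_linear h .
  have eq: "(\<lambda>z. of_real (h z)) =
      (\<lambda>z. ((of_real (h 1) - \<i> * of_real (h \<i>)) / 2) * z ^ 1 * cnj z ^ 0 +
        ((of_real (h 1) + \<i> * of_real (h \<i>)) / 2) * z ^ 0 * cnj z ^ 1)"
  proof
    fix z :: complex
    have "h z = h (Re z *\<^sub>R 1 + Im z *\<^sub>R \<i>)"
      by (rule arg_cong[of _ _ h]) (simp add: complex_eq_iff)
    also have "\<dots> = Re z * h 1 + Im z * h \<i>" by (simp only: add scaleR real_scaleR_def)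
    finally have "h z = Re z * h 1 + Im z * h \<i>" .
    thus "of_real (h z) = ((of_real (h 1) - \<i> * of_real (h \<i>)) / 2) * z ^ 1 * cnj z ^ 0 +
        ((of_real (h 1) + \<i> * of_real (h \<i>)) / 2) * z ^ 0 * cnj z ^ 1"
      by (simp add: complex_eq_iff field_simps)
  qed
  show ?case
    unfolding eq by (intro trig_poly.add trig_poly.monom)
next
  case (const c)
  show ?case by (rule trig_poly_const)
next
  case (add f g)
  show ?case unfolding of_real_add by (rule trig_poly.add[OF add.IH])
next
  case (mult f g)
  show ?case unfolding of_real_mult by (rule trig_poly_mult[OF mult.IH])
qed

lemma trig_poly_polynomial_function:
  assumes "polynomial_function (g :: complex \<Rightarrow> complex)"
  shows "trig_poly g"
proof -
  have "real_polynomial_function (Re \<circ> g)" "real_polynomial_function (Im \<circ> g)"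
    using assms bounded_linear_Re bounded_linear_Im by (auto simp: polynomial_function_def)
  hence "trig_poly (\<lambda>z. of_real ((Re \<circ> g) z) + \<i> * of_real ((Im \<circ> g) z))"
    by (intro trig_poly.add trig_poly_mult trig_poly_const trig_poly_real_polynomial_function)
  thus ?thesis by (simp add: complex_eq[symmetric] o_def)
qed

lemma continuous_on_trig_poly: "trig_poly f \<Longrightarrow> continuous_on S f"
  by (induction rule: trig_poly.induct) (auto intro!: continuous_intros)

text \<open>On the circle \<open>cnj z\<close> is the inverse of \<open>z\<close>. Writing negative
  powers as conjugates lets the power sums with \<open>k \<ge> 1\<close> decide every
  monomial.\<close>

lemma trig_poly_monom_on_circle:
  assumes "cmod z = 1"
  shows "c * z ^ i * cnj z ^ j = (if j \<le> i then c * z ^ (i - j) else c * cnj (z ^ (j - i)))"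
proof -
  have 1: "z * cnj z = 1" using assms by (simp flip: complex_norm_square)
  show ?thesis
  proof (cases "j \<le> i")
    case True
    then obtain k where "i = j + k" using le_Suc_ex by blast
    moreover have "z ^ j * cnj z ^ j = 1" by (simp only: power_mult_distrib[symmetric] 1 power_one)
    ultimately show ?thesis by (simp add: power_add mult_ac)
  next
    case False
    then obtain k where "j = i + k" using le_Suc_ex nat_le_linear by metis
    moreover have "z ^ i * cnj z ^ i = 1" by (simp only: power_mult_distrib[symmetric] 1 power_one)
    ultimately show ?thesis using False by (simp add: power_add mult_ac)
  qed
qed

text \<open>Power sums settle monomials, linearity settles trigonometric polynomials, and uniform
  approximation on the circle settles \<open>f\<close>. The points are a family \<open>d\<close>
  over a finite set because several zeros may share a direction and must be counted
  separately.\<close>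

theorem weyl_criterion_circle:
  fixes A :: "nat \<Rightarrow> 'a set" and d :: "'a \<Rightarrow> complex"
  assumes card: "\<And>n. n \<ge> 1 \<Longrightarrow> card (A n) = n"
    and d: "\<And>z. cmod (d z) = 1"
    and lim: "\<And>k. k \<ge> 1 \<Longrightarrow> (\<lambda>n. (\<Sum>z\<in>A n. d z ^ k) / of_nat n) \<longlonglongrightarrow> 0"
    and f: "continuous_on UNIV f"
  shows "(\<lambda>n. (\<Sum>z\<in>A n. f (d z)) / of_nat n) \<longlonglongrightarrow> circle_mean f"
proof -
  define M where "M = (\<lambda>g n. (\<Sum>z\<in>A n. g (d z)) / of_nat n :: complex)"
  have poly: "M g \<longlonglongrightarrow> circle_mean g" if "trig_poly g" for g
    using that
  proof induction
    case (monom c i j)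
    have circ: "circle_mean (\<lambda>z. c * z ^ i * cnj z ^ j) =
        circle_mean (\<lambda>z. if j \<le> i then c * z ^ (i - j) else c * cnj (z ^ (j - i)))"
      by (rule circle_mean_cong) (rule trig_poly_monom_on_circle)
    have M: "M (\<lambda>z. c * z ^ i * cnj z ^ j) n =
        (\<Sum>z\<in>A n. if j \<le> i then c * d z ^ (i - j) else c * cnj (d z ^ (j - i))) / of_nat n" for n
      unfolding M_def
      by (intro arg_cong2[of _ _ _ _ "(/)"] sum.cong refl trig_poly_monom_on_circle d)
    consider "i = j" | "j < i" | "i < j" by linarith
    thus ?case
    proof cases
      case 1
      have "\<forall>\<^sub>F n in sequentially. c = M (\<lambda>z. c * z ^ i * cnj z ^ j) n"
        using eventually_ge_at_top[of 1] by eventually_elim (unfold M, simp add: 1 card)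
      hence "M (\<lambda>z. c * z ^ i * cnj z ^ j) \<longlonglongrightarrow> c"
        by (rule Lim_transform_eventually[OF tendsto_const])
      moreover have "circle_mean (\<lambda>z. c * z ^ i * cnj z ^ j) = c"
        unfolding circ using 1 by (simp add: circle_mean_const)
      ultimately show ?thesis by (simp only:)
    next
      case 2
      have "(\<lambda>n. c * ((\<Sum>z\<in>A n. d z ^ (i - j)) / of_nat n)) \<longlonglongrightarrow> c * 0"
        using 2 by (intro tendsto_mult tendsto_const lim) auto
      moreover have "M (\<lambda>z. c * z ^ i * cnj z ^ j) = (\<lambda>n. c * ((\<Sum>z\<in>A n. d z ^ (i - j)) / of_nat n))"
        using 2 by (simp add: M fun_eq_iff sum_distrib_left)
      ultimately show ?thesis using 2 by (simp add: circ circle_mean_cmult circle_mean_power)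
    next
      case 3
      have "(\<lambda>n. c * cnj ((\<Sum>z\<in>A n. d z ^ (j - i)) / of_nat n)) \<longlonglongrightarrow> c * cnj 0"
        using 3 by (intro tendsto_mult tendsto_const tendsto_cnj lim) auto
      moreover have "M (\<lambda>z. c * z ^ i * cnj z ^ j) = (\<lambda>n. c * cnj ((\<Sum>z\<in>A n. d z ^ (j - i)) / of_nat n))"
        using 3 by (simp add: M fun_eq_iff sum_distrib_left)
      moreover have "circle_mean (\<lambda>z. cnj z ^ (j - i)) = 0"
        using circle_mean_cnj[of "\<lambda>z. z ^ (j - i)"] 3 by (simp add: circle_mean_power)
      ultimately show ?thesis using 3 by (simp add: circ circle_mean_cmult)
    qed
  next
    case (add f g)
    have "M (\<lambda>z. f z + g z) = (\<lambda>n. M f n + M g n)"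
      by (simp add: M_def fun_eq_iff sum.distrib add_divide_distrib)
    thus ?case using add
      by (simp add: circle_mean_add continuous_on_trig_poly tendsto_add)
  qed
  have "M f \<longlonglongrightarrow> circle_mean f"
  proof (rule LIMSEQ_I)
    fix e :: real assume "e > 0"
    hence e: "e / 4 > 0" by simp
    have "continuous_on (sphere 0 1) f" using f by (rule continuous_on_subset) simp
    then obtain g where g: "polynomial_function g" "\<And>z. z \<in> sphere 0 1 \<Longrightarrow> cmod (f z - g z) < e / 4"
      using Stone_Weierstrass_polynomial_function[OF compact_sphere _ e, where f = f] by metis
    have tg: "trig_poly g" by (rule trig_poly_polynomial_function[OF g(1)])
    have close: "cmod (f z - g z) \<le> e / 4" if "cmod z = 1" for z
      using g(2)[of z] that by simp
    obtain N where N: "\<And>n. n \<ge> N \<Longrightarrow> cmod (M g n - circle_mean g) < e / 4"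
      using LIMSEQ_D[OF poly[OF tg] e] by blast
    have circ: "cmod (circle_mean f - circle_mean g) \<le> e / 4"
      by (rule norm_circle_mean_diff_le[OF f continuous_on_trig_poly[OF tg] close])
    have "cmod (M f n - circle_mean f) < e" if n: "n \<ge> max N 1" for n
    proof -
      have "M f n - M g n = (\<Sum>z\<in>A n. f (d z) - g (d z)) / of_nat n"
        by (simp add: M_def sum_subtractf diff_divide_distrib)
      also have "cmod \<dots> \<le> (\<Sum>z\<in>A n. e / 4) / real n"
        unfolding norm_divide norm_of_nat
        by (intro divide_right_mono sum_norm_le close d) auto
      also have "\<dots> = e / 4" using n card[of n] by simp
      finally have 1: "cmod (M f n - M g n) \<le> e / 4" .
      have 2: "cmod (M g n - circle_mean g) < e / 4" using N n by simp
      have 3: "cmod (circle_mean g - circle_mean f) \<le> e / 4"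
        using circ by (simp add: norm_minus_commute)
      have "M f n - circle_mean f =
          (M f n - M g n) + (M g n - circle_mean g) + (circle_mean g - circle_mean f)" by simp
      also have "cmod \<dots> \<le> cmod (M f n - M g n) + cmod (M g n - circle_mean g) +
          cmod (circle_mean g - circle_mean f)"
        by (intro order_trans[OF norm_triangle_ineq] add_right_mono norm_triangle_ineq)
      also have "\<dots> < e" using 1 2 3 e by linarith
      finally show ?thesis .
    qed
    thus "\<exists>N. \<forall>n\<ge>N. cmod (M f n - circle_mean f) < e" by blast
  qed
  thus ?thesis by (simp add: M_def)
qed

section \<open>Equidistribution of the zeros\<close>

text \<open>The value at 0 is an arbitrary point of the circle, so that
  \<open>cmod_direction\<close> holds without exception.\<close>

definition direction :: "complex \<Rightarrow> complex" where
  "direction z = (if z = 0 then 1 else sgn z)"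

text \<open>One quantity for both sides of the circle: for an outer zero it is
  \<open>1 - 1 / cmod z\<close>, below 1 however far away the zero lies.\<close>

definition defect :: "complex \<Rightarrow> real" where
  "defect z = 1 - cmod (inner_reflection z)"

lemma cmod_direction: "cmod (direction z) = 1"
  by (simp add: direction_def norm_sgn)

lemma inner_reflection_polar:
  "inner_reflection z = of_real (cmod (inner_reflection z)) * direction z"
proof (cases "cmod z \<le> 1")
  case True
  thus ?thesis by (simp add: inner_reflection_def direction_def sgn_div_norm scaleR_conv_of_real)
next
  case False
  hence nz: "z \<noteq> 0" by auto
  have "1 / cnj z = z / (z * cnj z)" using nz by simp
  also have "z * cnj z = of_real ((cmod z)\<^sup>2)" by (rule complex_norm_square[symmetric])
  finally have "1 / cnj z = of_real (1 / cmod z) * sgn z"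
    using nz by (simp add: sgn_div_norm scaleR_conv_of_real power2_eq_square divide_inverse mult_ac)
  thus ?thesis using False nz by (simp add: inner_reflection_def direction_def norm_divide norm_sgn)
qed

lemma defect_nonneg: "defect z \<ge> 0"
  using cmod_inner_reflection_le_1[of z] by (simp add: defect_def)

text \<open>Reflection preserves the argument, so the difference has modulus
  \<open>1 - r ^ k\<close>, and Bernoulli's inequality applies.\<close>

lemma norm_power_diff_direction_le:
  "cmod (inner_reflection z ^ k - direction z ^ k) \<le> real k * defect z"
proof -
  define r where "r = cmod (inner_reflection z)"
  have r: "0 \<le> r" "r \<le> 1" using cmod_inner_reflection_le_1[of z] by (auto simp: r_def)
  have "inner_reflection z ^ k - direction z ^ k = of_real (r ^ k - 1) * direction z ^ k"
    by (subst inner_reflection_polar) (simp add: r_def power_mult_distrib algebra_simps)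
  hence "cmod (inner_reflection z ^ k - direction z ^ k) = \<bar>r ^ k - 1\<bar>"
    by (simp only: norm_mult norm_power cmod_direction norm_of_real power_one mult_1_right)
  also have "\<dots> = 1 - r ^ k" using r by (simp add: power_le_one)
  also have "\<dots> \<le> real k * (1 - r)"
    using Bernoulli_inequality[of "r - 1" k] r by (simp add: algebra_simps)
  finally show ?thesis by (simp add: defect_def r_def)
qed

text \<open>The hypothesis excludes 0 and forces \<open>cmod z \<le> 2\<close>. Outside the disk
  \<open>cmod z - 1\<close> equals \<open>cmod z * defect z\<close>, whence the factor 2.\<close>

lemma norm_diff_direction_le:
  assumes "defect z \<le> 1 / 2"
  shows "cmod (z - direction z) \<le> 2 * defect z"
proof -
  have z: "z \<noteq> 0" using assms by (auto simp: defect_def inner_reflection_def)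
  have "z - direction z = of_real (cmod z - 1) * sgn z"
    using z by (simp add: direction_def sgn_div_norm scaleR_conv_of_real field_simps)
  hence eq: "cmod (z - direction z) = \<bar>cmod z - 1\<bar>"
    using z by (simp only: norm_mult norm_sgn norm_of_real) simp
  show ?thesis
  proof (cases "cmod z \<le> 1")
    case True
    thus ?thesis using eq by (simp add: defect_def inner_reflection_def)
  next
    case False
    hence d: "defect z = 1 - 1 / cmod z" by (simp add: defect_def inner_reflection_def norm_divide)
    hence "1 / 2 \<le> 1 / cmod z" using assms by linarith
    hence "cmod z \<le> 2" using z by (simp add: field_simps)
    hence "cmod z * defect z \<le> 2 * defect z" by (rule mult_right_mono[OF _ defect_nonneg])
    moreover have "cmod z * defect z = cmod z - 1" using z by (simp add: d field_simps)
    ultimately show ?thesis using eq False by simp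
  qed
qed

section \<open>Test functions compared at a point and at its direction\<close>

lemma compactly_supported_bounded:
  fixes f :: "complex \<Rightarrow> complex"
  assumes "continuous_on UNIV f" "compact (closure {z. f z \<noteq> 0})"
  obtains B where "B > 0" "\<And>z. cmod (f z) \<le> B"
proof -
  have "compact (f ` closure {z. f z \<noteq> 0})"
    using assms by (intro compact_continuous_image) (auto intro: continuous_on_subset)
  then obtain B where B: "B > 0" "\<And>w. w \<in> f ` closure {z. f z \<noteq> 0} \<Longrightarrow> cmod w \<le> B"
    using compact_imp_bounded bounded_pos by metis
  have "cmod (f z) \<le> B" for z
  proof (cases "f z = 0")
    case False
    hence "z \<in> closure {z. f z \<noteq> 0}" by (intro subsetD[OF closure_subset]) simp
    thus ?thesis by (intro B imageI)
  qed (use B in simp)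
  with B show ?thesis using that by blast
qed

text \<open>Near the circle uniform continuity gives \<open>e\<close>. Elsewhere the defect is at
  least \<eta>, so the trivial bound \<open>2 * B\<close> is absorbed into
  \<open>C * defect z\<close>, which is small on average over the zeros.\<close>

lemma compactly_supported_close_direction:
  fixes f :: "complex \<Rightarrow> complex"
  assumes "continuous_on UNIV f" "compact (closure {z. f z \<noteq> 0})" "e > 0"
  obtains C where "C \<ge> 0" "\<And>z. cmod (f z - f (direction z)) \<le> e + C * defect z"
proof -
  obtain B where B: "B > 0" "\<And>z. cmod (f z) \<le> B"
    using compactly_supported_bounded[OF assms(1,2)] by blast
  have "uniformly_continuous_on (cball 0 2) f"
    using assms(1) by (intro compact_uniformly_continuous) (auto intro: continuous_on_subset)
  then obtain s where s: "s > 0"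
    "\<And>x y. x \<in> cball 0 2 \<Longrightarrow> y \<in> cball 0 2 \<Longrightarrow> dist y x < s \<Longrightarrow> dist (f y) (f x) < e"
    using assms(3) unfolding uniformly_continuous_on_def by metis
  \<comment> \<open>The bound 1/2 admits \<open>norm_diff_direction_le\<close> and keeps
    \<open>z\<close> in \<open>cball 0 2\<close>; \<open>s / 3\<close> makes
    \<open>2 * defect z\<close> smaller than \<open>s\<close>.\<close>
  define \<eta> where "\<eta> = min (1 / 2) (s / 3)"
  have \<eta>: "\<eta> > 0" using s by (simp add: \<eta>_def)
  have "cmod (f z - f (direction z)) \<le> e + 2 * B / \<eta> * defect z" for z
  proof (cases "defect z < \<eta>")
    case True
    have d: "cmod (z - direction z) \<le> 2 * defect z"
      using True by (intro norm_diff_direction_le) (simp add: \<eta>_def)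
    have "cmod z \<le> cmod (z - direction z) + cmod (direction z)"
      using norm_triangle_ineq[of "z - direction z" "direction z"] by simp
    hence "cmod z \<le> 2" using d True cmod_direction[of z] by (simp add: \<eta>_def)
    moreover have "dist z (direction z) < s" using d True s by (simp add: \<eta>_def dist_norm)
    ultimately have "dist (f z) (f (direction z)) < e"
      by (intro s) (auto simp: cmod_direction)
    moreover have "2 * B / \<eta> * defect z \<ge> 0" using B \<eta> defect_nonneg by simp
    ultimately show ?thesis by (simp add: dist_norm)
  next
    case False
    have "cmod (f z - f (direction z)) \<le> B + B"
      by (intro order_trans[OF norm_triangle_ineq4] add_mono B)
    also have "\<dots> = 2 * B / \<eta> * \<eta>" using \<eta> by simp
    also have "\<dots> \<le> 2 * B / \<eta> * defect z" using False B \<eta> by (intro mult_left_mono) auto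
    finally show ?thesis using assms(3) by linarith
  qed
  moreover have "2 * B / \<eta> \<ge> 0" using B \<eta> by simp
  ultimately show ?thesis using that by blast
qed

section \<open>Defects, zero counting measure and power means of one polynomial\<close>

context simple_int_poly
begin

text \<open>Inside the disk defect and gap coincide; outside,
  \<open>1 - 1 / cmod z \<le> ln (cmod z)\<close>, the share of the zero in
  \<open>L\<close>.\<close>

lemma sum_defect_le: "(\<Sum>z\<in>Z. defect z) \<le> (\<Sum>z\<in>Z. gap z) + L"
proof -
  have "defect z \<le> gap z + ln (max 1 (cmod z))" for z
  proof (cases "cmod z \<le> 1")
    case False
    hence "z \<noteq> 0" by auto
    hence "1 - 1 / cmod z \<le> ln (cmod z)"
      using ln_le_minus_one[of "1 / cmod z"] by (simp add: ln_div)
    with False show ?thesis by (simp add: defect_def inner_reflection_def gap_def norm_divide)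
  qed (simp add: defect_def inner_reflection_def gap_def)
  hence "(\<Sum>z\<in>Z. defect z) \<le> (\<Sum>z\<in>Z. gap z + ln (max 1 (cmod z)))" by (rule sum_mono)
  also have "\<dots> \<le> (\<Sum>z\<in>Z. gap z) + L" using ln_a_nonneg by (simp add: sum.distrib L_def)
  finally show ?thesis .
qed

text \<open>Simple zeros have order 1, so all weights equal \<open>1 / n\<close>.\<close>

lemma integral_zero_counting_measure:
  fixes f :: "complex \<Rightarrow> complex"
  assumes "continuous_on UNIV f"
  shows "(LINT z|zero_counting_measure p. f z) = (\<Sum>z\<in>Z. f z) / of_nat n"
proof -
  have f: "f \<in> borel_measurable borel"
    using assms by (rule borel_measurable_continuous_onI)
  have "(LINT z|zero_counting_measure p. f z) =
      (LINT z|point_measure Z (\<lambda>z. ennreal (real (Polynomial.order z p) / real (degree p))). f z)"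
    unfolding zero_counting_measure_def Z_def
    by (subst integral_distr) (use f in \<open>auto simp: measurable_point_measure_eq1 space_point_measure\<close>)
  also have "\<dots> = (\<Sum>z\<in>Z. (real (Polynomial.order z p) / real (degree p)) *\<^sub>R f z)"
    by (rule lebesgue_integral_point_measure_finite[OF finite_Z]) simp
  also have "\<dots> = (\<Sum>z\<in>Z. f z / of_nat n)"
    using rsquarefree p_nz
    by (intro sum.cong) (auto simp: rsquarefree_root_order Z_def degree_p scaleR_conv_of_real)
  finally show ?thesis by (simp add: sum_divide_distrib)
qed

lemma norm_mean_power_le:
  assumes \<rho>: "0 < \<rho>" "\<rho> < 1" and k: "k \<ge> 1"
  shows "cmod ((\<Sum>z\<in>Z. inner_reflection z ^ k) / of_nat n) \<le>
    sqrt (real k / \<rho> ^ k * (2 * (L / real n) + ln (2 / (1 + \<rho>)) - ln (1 - \<rho>) / real n))"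
proof (rule real_le_rsqrt)
  let ?S = "\<Sum>z\<in>Z. inner_reflection z ^ k" and ?E = "2 * (L / real n) + ln (2 / (1 + \<rho>)) - ln (1 - \<rho>) / real n"
  have n: "real n > 0" using degree_pos by simp
  have "2 * real n * L + (real n)\<^sup>2 * ln (2 / (1 + \<rho>)) - real n * ln (1 - \<rho>) = (real n)\<^sup>2 * ?E"
    using n by (simp add: field_simps power2_eq_square)
  hence "\<rho> ^ k / real k * (cmod ?S)\<^sup>2 \<le> (real n)\<^sup>2 * ?E"
    using energy_bound[OF \<rho>, of k] by simp
  hence "(cmod ?S)\<^sup>2 \<le> real k / \<rho> ^ k * ((real n)\<^sup>2 * ?E)"
    using \<rho> k by (simp add: field_simps)
  also have "\<dots> = real k / \<rho> ^ k * ?E * (real n)\<^sup>2" by (simp only: mult_ac)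
  finally have "(cmod ?S)\<^sup>2 / (real n)\<^sup>2 \<le> real k / \<rho> ^ k * ?E"
    using n by (subst pos_divide_le_eq) auto
  thus "(cmod (?S / of_nat n))\<^sup>2 \<le> real k / \<rho> ^ k * ?E"
    by (simp add: norm_divide power_divide)
qed

end

theorem theorem2p1:
  fixes P :: "nat \<Rightarrow> int poly"
  assumes "\<And>n. n \<ge> 1 \<Longrightarrow> degree (P n) = n"
    and "\<And>n. n \<ge> 1 \<Longrightarrow> rsquarefree (map_poly of_int (P n) :: complex poly)"
    and "(\<lambda>n. area_mahler (map_poly of_int (P n)) powr (1 / real n)) \<longlonglongrightarrow> 1"
  shows "weak_star_converges (\<lambda>n. zero_counting_measure (map_poly of_int (P n))) unit_circle_measure"
proof -
  define A where "A n = area_mahler (map_poly of_int (P n) :: complex poly)" for n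
  define Z where "Z n = simple_int_poly.Z (P n)" for n
  define L where "L n = simple_int_poly.L (P n)" for n
  define T where "T n = (\<Sum>z\<in>Z n. gap z)" for n
  \<comment> \<open>Nothing is assumed about \<open>P 0\<close>, so facts from the locale are
    available for \<open>n \<ge> 1\<close> and enter the limits through eventual statements.\<close>
  have sip: "simple_int_poly (P n)" if "n \<ge> 1" for n
    using assms(1,2)[OF that] that by unfold_locales auto
  have deg: "degree (P n) = n" if "n \<ge> 1" for n by (rule assms(1)[OF that])
  have card: "card (Z n) = n" if "n \<ge> 1" for n
    using simple_int_poly.card_Z[OF sip[OF that]] deg[OF that] by (simp add: Z_def)
  \<comment> \<open>The hypothesis in the form that the estimates need: \<open>ln (A n)\<close> is
    o(n).\<close>
  have "(\<lambda>n. ln (A n powr (1 / real n))) \<longlonglongrightarrow> ln 1"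
    using assms(3) unfolding A_def by (intro tendsto_ln) auto
  moreover have "A n > 0" for n by (simp add: A_def area_mahler_def)
  ultimately have lnA: "(\<lambda>n. ln (A n) / real n) \<longlonglongrightarrow> 0"
    by (simp add: ln_powr)
  have T_le: "T n / real n \<le> sqrt (ln (A n) / real n + (3 / 2) / real n)" if n: "n \<ge> 1" for n
  proof -
    have "T n / real n \<le> sqrt (real n * (ln (A n) + 3 / 2)) / real n"
      using simple_int_poly.sum_gap_le[OF sip[OF n]] deg[OF n]
      by (intro divide_right_mono) (auto simp: T_def Z_def A_def)
    also have "\<dots> = sqrt (real n * (ln (A n) + 3 / 2) / (real n)\<^sup>2)"
      using n by (simp add: real_sqrt_divide)
    also have "real n * (ln (A n) + 3 / 2) / (real n)\<^sup>2 = ln (A n) / real n + (3 / 2) / real n"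
      using n by (simp add: power2_eq_square add_divide_distrib)
    finally show ?thesis .
  qed
  have "(\<lambda>n. sqrt (ln (A n) / real n + (3 / 2) / real n)) \<longlonglongrightarrow> sqrt (0 + 0)"
    by (intro tendsto_real_sqrt tendsto_add lnA lim_const_over_n)
  hence lim_sqrt: "(\<lambda>n. sqrt (ln (A n) / real n + (3 / 2) / real n)) \<longlonglongrightarrow> 0" by simp
  have lim_T: "(\<lambda>n. T n / real n) \<longlonglongrightarrow> 0"
  proof (rule tendsto_sandwich[OF _ _ tendsto_const lim_sqrt])
    show "\<forall>\<^sub>F n in sequentially. 0 \<le> T n / real n"
      unfolding T_def
      by (intro always_eventually allI divide_nonneg_nonneg sum_nonneg gap_bounds) auto
    show "\<forall>\<^sub>F n in sequentially. T n / real n \<le> sqrt (ln (A n) / real n + (3 / 2) / real n)"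
      by (intro eventually_sequentiallyI[of 1] T_le)
  qed
  have lim_L: "(\<lambda>n. L n / real n) \<longlonglongrightarrow> 0"
  proof (rule tendsto_sandwich[OF _ _ tendsto_const])
    show "\<forall>\<^sub>F n in sequentially. 0 \<le> L n / real n"
      using eventually_ge_at_top[of 1]
      by eventually_elim (auto simp: L_def intro!: divide_nonneg_nonneg simple_int_poly.L_nonneg sip)
    show "\<forall>\<^sub>F n in sequentially. L n / real n \<le> ln (A n) / real n + T n / real n"
      using eventually_ge_at_top[of 1]
    proof eventually_elim
      case (elim n)
      have "L n \<le> ln (A n) + T n"
        using simple_int_poly.L_le[OF sip[OF elim]] by (simp add: L_def A_def T_def Z_def)
      thus ?case by (simp add: divide_right_mono flip: add_divide_distrib)
    qed
    show "(\<lambda>n. ln (A n) / real n + T n / real n) \<longlonglongrightarrow> 0"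
      using tendsto_add[OF lnA lim_T] by simp
  qed
  have lim_defect: "(\<lambda>n. (\<Sum>z\<in>Z n. defect z) / real n) \<longlonglongrightarrow> 0"
  proof (rule tendsto_sandwich[OF _ _ tendsto_const])
    show "\<forall>\<^sub>F n in sequentially. 0 \<le> (\<Sum>z\<in>Z n. defect z) / real n"
      by (intro always_eventually allI divide_nonneg_nonneg sum_nonneg defect_nonneg) auto
    show "\<forall>\<^sub>F n in sequentially. (\<Sum>z\<in>Z n. defect z) / real n \<le> T n / real n + L n / real n"
      using eventually_ge_at_top[of 1]
    proof eventually_elim
      case (elim n)
      have "(\<Sum>z\<in>Z n. defect z) \<le> T n + L n"
        using simple_int_poly.sum_defect_le[OF sip[OF elim]] by (simp add: L_def T_def Z_def)
      thus ?case by (simp add: divide_right_mono flip: add_divide_distrib)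
    qed
    show "(\<lambda>n. T n / real n + L n / real n) \<longlonglongrightarrow> 0"
      using tendsto_add[OF lim_T lim_L] by simp
  qed
  have lim_power: "(\<lambda>n. (\<Sum>z\<in>Z n. inner_reflection z ^ k) / of_nat n) \<longlonglongrightarrow> 0" if k: "k \<ge> 1" for k
  proof -
    \<comment> \<open>The choice \<open>\<rho> = 1 - 1 / n\<close>: after division by
      \<open>n\<^sup>2\<close> damping costs O(1/n) and the diagonal
      \<open>ln n / n\<close>.\<close>
    define R where "R n = sqrt (real k / (1 - 1 / real n) ^ k *
      (2 * (L n / real n) + ln (2 / (1 + (1 - 1 / real n))) - ln (1 - (1 - 1 / real n)) / real n))" for n
    have "(\<lambda>n. ln (2 / (1 + (1 - 1 / real n))) - ln (1 - (1 - 1 / real n)) / real n) \<longlonglongrightarrow> 0"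
      by real_asymp
    from tendsto_add[OF tendsto_mult[OF tendsto_const[of 2] lim_L] this]
    have 1: "(\<lambda>n. 2 * (L n / real n) + ln (2 / (1 + (1 - 1 / real n))) -
        ln (1 - (1 - 1 / real n)) / real n) \<longlonglongrightarrow> 0" by (simp add: algebra_simps)
    have "(\<lambda>n. real k / (1 - 1 / real n) ^ k) \<longlonglongrightarrow> real k / (1 - 0) ^ k"
      by (intro tendsto_divide tendsto_const tendsto_power tendsto_diff lim_const_over_n) auto
    from tendsto_real_sqrt[OF tendsto_mult[OF this 1]] have lim_R: "R \<longlonglongrightarrow> 0"
      by (simp add: R_def[abs_def])
    have "\<forall>\<^sub>F n in sequentially. cmod ((\<Sum>z\<in>Z n. inner_reflection z ^ k) / of_nat n) \<le> R n"
      \<comment> \<open>At \<open>n = 1\<close> the damping parameter would be 0, outside the range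
        of \<open>norm_mean_power_le\<close>.\<close>
      using eventually_ge_at_top[of 2]
    proof eventually_elim
      case (elim n)
      hence "n \<ge> 1" "0 < 1 - 1 / real n" "1 - 1 / real n < 1" by (auto simp: field_simps)
      thus ?case
        using simple_int_poly.norm_mean_power_le[OF sip, of n "1 - 1 / real n" k] k deg[of n]
        unfolding R_def Z_def L_def by simp
    qed
    thus ?thesis by (rule Lim_null_comparison[OF _ lim_R])
  qed
  \<comment> \<open>Weyl's criterion needs points on the circle itself; passing from reflections to
    directions changes the \<open>k\<close>-th mean by at most \<open>k\<close> times the mean
    defect.\<close>
  have lim_direction: "(\<lambda>n. (\<Sum>z\<in>Z n. direction z ^ k) / of_nat n) \<longlonglongrightarrow> 0" if k: "k \<ge> 1" for k
  proof -
    have "(\<lambda>n. real k * ((\<Sum>z\<in>Z n. defect z) / real n)) \<longlonglongrightarrow> real k * 0"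
      by (intro tendsto_mult tendsto_const lim_defect)
    hence lim: "(\<lambda>n. real k * ((\<Sum>z\<in>Z n. defect z) / real n)) \<longlonglongrightarrow> 0" by simp
    have le: "cmod ((\<Sum>z\<in>Z n. inner_reflection z ^ k) / of_nat n -
        (\<Sum>z\<in>Z n. direction z ^ k) / of_nat n) \<le> real k * ((\<Sum>z\<in>Z n. defect z) / real n)" for n
    proof -
      have "cmod (\<Sum>z\<in>Z n. inner_reflection z ^ k - direction z ^ k) \<le> (\<Sum>z\<in>Z n. real k * defect z)"
        by (intro sum_norm_le norm_power_diff_direction_le)
      thus ?thesis
        by (simp add: norm_divide divide_right_mono sum_subtractf sum_distrib_left
            flip: diff_divide_distrib)
    qed
    have "(\<lambda>n. (\<Sum>z\<in>Z n. inner_reflection z ^ k) / of_nat n -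
        (\<Sum>z\<in>Z n. direction z ^ k) / of_nat n) \<longlonglongrightarrow> 0"
      by (rule Lim_null_comparison[OF always_eventually lim]) (use le in blast)
    from tendsto_diff[OF lim_power[OF k] this] show ?thesis by simp
  qed
  show ?thesis
    unfolding weak_star_converges_def
  proof (intro allI impI)
    fix f :: "complex \<Rightarrow> complex"
    assume f: "continuous_on UNIV f" "compact (closure {z. f z \<noteq> 0})"
    have circle: "(\<lambda>n. (\<Sum>z\<in>Z n. f (direction z)) / of_nat n) \<longlonglongrightarrow> circle_mean f"
      by (rule weyl_criterion_circle[OF card cmod_direction lim_direction f(1)])
    have "(\<lambda>n. (\<Sum>z\<in>Z n. f z) / of_nat n - (\<Sum>z\<in>Z n. f (direction z)) / of_nat n) \<longlonglongrightarrow> 0"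
    proof (rule LIMSEQ_I)
      fix e :: real assume "e > 0"
      hence e: "e / 2 > 0" by simp
      obtain C where C: "C \<ge> 0" "\<And>z. cmod (f z - f (direction z)) \<le> e / 2 + C * defect z"
        using compactly_supported_close_direction[OF f e] by blast
      have "(\<lambda>n. C * ((\<Sum>z\<in>Z n. defect z) / real n)) \<longlonglongrightarrow> C * 0"
        by (intro tendsto_mult tendsto_const lim_defect)
      hence "(\<lambda>n. C * ((\<Sum>z\<in>Z n. defect z) / real n)) \<longlonglongrightarrow> 0" by simp
      from order_tendstoD(2)[OF this e]
      obtain N where N: "\<And>n. n \<ge> N \<Longrightarrow> C * ((\<Sum>z\<in>Z n. defect z) / real n) < e / 2"
        unfolding eventually_sequentially by blast
      have "cmod ((\<Sum>z\<in>Z n. f z) / of_nat n - (\<Sum>z\<in>Z n. f (direction z)) / of_nat n - 0) < e"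
        if n: "n \<ge> max N 1" for n
      proof -
        have "cmod ((\<Sum>z\<in>Z n. f z) / of_nat n - (\<Sum>z\<in>Z n. f (direction z)) / of_nat n - 0) =
            cmod (\<Sum>z\<in>Z n. f z - f (direction z)) / real n"
          by (simp add: sum_subtractf norm_divide flip: diff_divide_distrib)
        also have "\<dots> \<le> (\<Sum>z\<in>Z n. e / 2 + C * defect z) / real n"
          by (intro divide_right_mono sum_norm_le C) auto
        also have "\<dots> = e / 2 + C * ((\<Sum>z\<in>Z n. defect z) / real n)"
          using n card[of n] by (simp add: sum.distrib sum_distrib_left add_divide_distrib)
        also have "\<dots> < e"
        proof -
          have "C * ((\<Sum>z\<in>Z n. defect z) / real n) < e / 2" by (rule N) (use n in simp)
          thus ?thesis by linarith
        qed
        finally show ?thesis .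
      qed
      thus "\<exists>N. \<forall>n\<ge>N. cmod ((\<Sum>z\<in>Z n. f z) / of_nat n -
          (\<Sum>z\<in>Z n. f (direction z)) / of_nat n - 0) < e" by blast
    qed
    from tendsto_add[OF this circle]
    have "(\<lambda>n. (\<Sum>z\<in>Z n. f z) / of_nat n) \<longlonglongrightarrow> circle_mean f" by simp
    moreover have "\<forall>\<^sub>F n in sequentially. (\<Sum>z\<in>Z n. f z) / of_nat n =
        (LINT z|zero_counting_measure (map_poly of_int (P n)). f z)"
      using eventually_ge_at_top[of 1]
      by eventually_elim
         (simp add: simple_int_poly.integral_zero_counting_measure[OF sip f(1)] deg Z_def)
    ultimately have "(\<lambda>n. LINT z|zero_counting_measure (map_poly of_int (P n)). f z)
        \<longlonglongrightarrow> circle_mean f"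
      by (rule Lim_transform_eventually)
    thus "(\<lambda>n. LINT z|zero_counting_measure (map_poly of_int (P n)). f z)
        \<longlonglongrightarrow> (LINT z|unit_circle_measure. f z)"
      by (simp only: integral_unit_circle_measure[OF f(1)])
  qed
qed

end
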